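(* Let $H$ and $Y$ be Hilbert spaces, let $(T(t))_{t\ge0}$ be an analytic and bounded $C_0$-semigroup on $H$ with infinitesimal generator $A$, and let $C=S(-A)^\alpha$, where $S$ is a bounded linear operator from $H$ to $Y$ and $\alpha\in(0,\tfrac12)$. Then $C$ is a zero-class admissible observation operator for $(T(t))_{t\ge0}$.
   Context: An operator $C: D(A)\to Y$, bounded with respect to the graph norm on $D(A)$, is a finite-time admissible observation operator for $(T(t))_{t\ge0}$ if for each $\eta>0$ there is a constant $K_\eta>0$ with $$\int_0^\eta\|CT(t)x\|^2\,dt\le K_\eta^2\|x\|^2\qquad (x\in D(A)).$$ It is zero-class admissible if it is finite-time admissible and the best constants $K_\eta$ in this inequality satisfy $K_\eta\to0$ as $\eta\to0$. *)

theory Defs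
  imports "HOL-Analysis.Analysis"
begin

section \<open>Complex Hilbert spaces\<close>

class scaleC =
  fixes scaleC :: "complex \<Rightarrow> 'a \<Rightarrow> 'a"  (infixr "*\<^sub>C" 75)

text \<open>The inner product is linear in its first argument and induces the norm of the
  underlying Banach space; the real scalar multiplication is the restriction of the complex one.\<close>

class chilbert_space = banach + scaleC +
  fixes cinner :: "'a \<Rightarrow> 'a \<Rightarrow> complex"
  assumes scaleC_add_right: "c *\<^sub>C (x + y) = c *\<^sub>C x + c *\<^sub>C y"
    and scaleC_add_left: "(c + d) *\<^sub>C x = c *\<^sub>C x + d *\<^sub>C x"
    and scaleC_scaleC: "c *\<^sub>C d *\<^sub>C x = (c * d) *\<^sub>C x"
    and scaleR_scaleC: "r *\<^sub>R x = complex_of_real r *\<^sub>C x"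
    and cinner_commute: "cinner x y = cnj (cinner y x)"
    and cinner_add_left: "cinner (x + y) z = cinner x z + cinner y z"
    and cinner_scaleC_left: "cinner (c *\<^sub>C x) y = c * cinner x y"
    and cinner_self: "cinner x x = complex_of_real ((norm x)\<^sup>2)"

instantiation complex :: chilbert_space
begin

definition scaleC_complex :: "complex \<Rightarrow> complex \<Rightarrow> complex"
  where "scaleC_complex c x = c * x"

definition cinner_complex :: "complex \<Rightarrow> complex \<Rightarrow> complex"
  where "cinner_complex x y = x * cnj y"

instance
  by standard
    (auto simp: scaleC_complex_def cinner_complex_def algebra_simps scaleR_conv_of_real
      simp flip: complex_norm_square)

end

definition bounded_clinear :: "('a::chilbert_space \<Rightarrow> 'b::chilbert_space) \<Rightarrow> bool"
  where "bounded_clinear f \<longleftrightarrow> bounded_linear f \<and> (\<forall>c x. f (c *\<^sub>C x) = c *\<^sub>C f x)"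

section \<open>Semigroups and their generators\<close>

text \<open>Semigroups are indexed by all of \<open>real\<close>; only the values at \<open>t \<ge> 0\<close> are relevant.\<close>

definition C0_semigroup :: "(real \<Rightarrow> 'h::chilbert_space \<Rightarrow> 'h) \<Rightarrow> bool"
  where "C0_semigroup T \<longleftrightarrow>
    (\<forall>t\<ge>0. bounded_clinear (T t)) \<and>
    T 0 = id \<and>
    (\<forall>s\<ge>0. \<forall>t\<ge>0. T (s + t) = T s \<circ> T t) \<and>
    (\<forall>x. ((\<lambda>t. T t x) \<longlongrightarrow> x) (at_right 0))"

definition bounded_semigroup :: "(real \<Rightarrow> 'h::chilbert_space \<Rightarrow> 'h) \<Rightarrow> bool"
  where "bounded_semigroup T \<longleftrightarrow> (\<exists>M. \<forall>t\<ge>0. \<forall>x. norm (T t x) \<le> M * norm x)"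

definition sector :: "real \<Rightarrow> complex set"
  where "sector \<delta> = {z. z \<noteq> 0 \<and> \<bar>Arg z\<bar> < \<delta>}"

text \<open>\<open>T\<close> is analytic if it extends to a semigroup on a sector about the positive half-line that
  is holomorphic there and strongly continuous at \<open>0\<close> on smaller sectors. Holomorphy is required
  for the orbits; by the uniform boundedness principle this amounts to holomorphy in operator
  norm. No bound on the extension is part of the definition.\<close>

definition analytic_semigroup :: "(real \<Rightarrow> 'h::chilbert_space \<Rightarrow> 'h) \<Rightarrow> bool"
  where "analytic_semigroup T \<longleftrightarrow>
    (\<exists>\<delta> (U :: complex \<Rightarrow> 'h \<Rightarrow> 'h). 0 < \<delta> \<and> \<delta> \<le> pi / 2 \<and>
      (\<forall>t\<ge>0. U (complex_of_real t) = T t) \<and>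
      (\<forall>z\<in>sector \<delta>. bounded_clinear (U z)) \<and>
      (\<forall>z\<in>insert 0 (sector \<delta>). \<forall>w\<in>insert 0 (sector \<delta>). U (z + w) = U z \<circ> U w) \<and>
      (\<forall>x. \<forall>z\<in>sector \<delta>.
        \<exists>d. ((\<lambda>w. inverse (w - z) *\<^sub>C (U w x - U z x)) \<longlongrightarrow> d) (at z)) \<and>
      (\<forall>\<delta>'. 0 < \<delta>' \<and> \<delta>' < \<delta> \<longrightarrow>
        (\<forall>x. ((\<lambda>z. U z x) \<longlongrightarrow> x) (at 0 within sector \<delta>'))))"

text \<open>Unbounded operators are partial functions; the domain of \<open>A\<close> is \<open>dom A\<close>.\<close>

definition generator :: "(real \<Rightarrow> 'h::chilbert_space \<Rightarrow> 'h) \<Rightarrow> 'h \<rightharpoonup> 'h"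
  where "generator T x =
    (if \<exists>y. ((\<lambda>t. (T t x - x) /\<^sub>R t) \<longlongrightarrow> y) (at_right 0)
     then Some (Lim (at_right 0) (\<lambda>t. (T t x - x) /\<^sub>R t))
     else None)"

definition neg_op :: "('h \<rightharpoonup> 'h::chilbert_space) \<Rightarrow> 'h \<rightharpoonup> 'h"
  where "neg_op A = map_option uminus \<circ> A"

section \<open>Fractional powers\<close>

text \<open>Fractional powers of order \<open>0 < \<alpha> < 1\<close> in the sense of Balakrishnan, for a densely defined
  operator \<open>B\<close> such that \<open>\<lambda> + B\<close> is invertible with \<open>\<lambda> (\<lambda> + B)\<^sup>-\<^sup>1\<close> uniformly bounded for
  \<open>\<lambda> > 0\<close>; this covers \<open>B = - A\<close> for every generator \<open>A\<close> of a bounded semigroup, without any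
  injectivity assumption on \<open>A\<close>. On \<open>dom B\<close> one puts
  \<open>B\<^sup>\<alpha> x = sin (\<pi> \<alpha>) / \<pi> \<integral>\<^sub>0\<^sup>\<infinity> \<lambda>\<^sup>\<alpha>\<^sup>-\<^sup>1 (\<lambda> + B)\<^sup>-\<^sup>1 B x d\<lambda>\<close>
  and \<open>B\<^sup>\<alpha>\<close> is the closure of this operator.\<close>

definition balakrishnan_graph ::
    "('h \<rightharpoonup> 'h::chilbert_space) \<Rightarrow> real \<Rightarrow> ('h \<times> 'h) set"
  where "balakrishnan_graph B \<alpha> =
    {(x, (sin (pi * \<alpha>) / pi) *\<^sub>R I) | x I. x \<in> dom B \<and>
      ((\<lambda>l. l powr (\<alpha> - 1) *\<^sub>R
          inv_into (dom B) (\<lambda>u. l *\<^sub>R u + the (B u)) (the (B x))) has_integral I) {0<..}}"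

definition frac_power :: "('h \<rightharpoonup> 'h::chilbert_space) \<Rightarrow> real \<Rightarrow> 'h \<rightharpoonup> 'h"
  where "frac_power B \<alpha> x =
    (if \<exists>!y. (x, y) \<in> closure (balakrishnan_graph B \<alpha>)
     then Some (THE y. (x, y) \<in> closure (balakrishnan_graph B \<alpha>))
     else None)"

section \<open>Admissible observation operators\<close>

definition observation_operator ::
    "('h \<rightharpoonup> 'h::chilbert_space) \<Rightarrow> ('h \<rightharpoonup> 'y::chilbert_space) \<Rightarrow> bool"
  where "observation_operator A C \<longleftrightarrow>
    dom C = dom A \<and>
    (\<forall>x\<in>dom A. \<forall>y\<in>dom A. the (C (x + y)) = the (C x) + the (C y)) \<and>
    (\<forall>c. \<forall>x\<in>dom A. the (C (c *\<^sub>C x)) = c *\<^sub>C the (C x)) \<and>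
    (\<exists>K. \<forall>x\<in>dom A. norm (the (C x)) \<le> K * (norm x + norm (the (A x))))"

definition admissibility_bound ::
    "(real \<Rightarrow> 'h::chilbert_space \<Rightarrow> 'h) \<Rightarrow> ('h \<rightharpoonup> 'y::chilbert_space) \<Rightarrow> real \<Rightarrow> real \<Rightarrow> bool"
  where "admissibility_bound T C \<eta> K \<longleftrightarrow>
    (\<forall>x\<in>dom (generator T).
      (\<lambda>t. (norm (the (C (T t x))))\<^sup>2) integrable_on {0..\<eta>} \<and>
      integral {0..\<eta>} (\<lambda>t. (norm (the (C (T t x))))\<^sup>2) \<le> K\<^sup>2 * (norm x)\<^sup>2)"

definition finite_time_admissible ::
    "(real \<Rightarrow> 'h::chilbert_space \<Rightarrow> 'h) \<Rightarrow> ('h \<rightharpoonup> 'y::chilbert_space) \<Rightarrow> bool"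
  where "finite_time_admissible T C \<longleftrightarrow>
    observation_operator (generator T) C \<and>
    (\<forall>\<eta>>0. \<exists>K>0. admissibility_bound T C \<eta> K)"

definition best_admissibility_constant ::
    "(real \<Rightarrow> 'h::chilbert_space \<Rightarrow> 'h) \<Rightarrow> ('h \<rightharpoonup> 'y::chilbert_space) \<Rightarrow> real \<Rightarrow> real"
  where "best_admissibility_constant T C \<eta> = Inf {K. K > 0 \<and> admissibility_bound T C \<eta> K}"

definition zero_class_admissible ::
    "(real \<Rightarrow> 'h::chilbert_space \<Rightarrow> 'h) \<Rightarrow> ('h \<rightharpoonup> 'y::chilbert_space) \<Rightarrow> bool"
  where "zero_class_admissible T C \<longleftrightarrow>
    finite_time_admissible T C \<and>
    (best_admissibility_constant T C \<longlongrightarrow> 0) (at_right 0)"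

end

theory Submission
  imports Defs "HOL-Complex_Analysis.Cauchy_Integral_Formula"
begin

text \<open>
  The theorem follows from one pointwise estimate: for every \<open>b > 0\<close> there is \<open>K\<close> with
  \<open>norm ((-A)\<^sup>\<alpha> (T t x)) \<le> K * t powr (- \<alpha>) * norm x\<close> for \<open>0 < t \<le> b\<close>. Since \<open>2 * \<alpha> < 1\<close>,
  its square is integrable at \<open>0\<close>, and the integral over \<open>{0..\<eta>}\<close> is at most a constant
  times \<open>\<eta> powr (1 - 2 * \<alpha>) * (norm x)\<^sup>2\<close>, which tends to \<open>0\<close> with \<open>\<eta>\<close>
  (\<open>zero_class_admissible_of_decay\<close>).

  The estimate combines two facts. The first is the smoothing property
  \<open>norm (A (T t x)) \<le> N / t * norm x\<close> of analytic semigroups. The definition of analyticity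
  contains no bound on the extension, so a Baire category argument
  (\<open>eventually_uniformly_bounded\<close>) first yields one near \<open>0\<close> on a smaller sector; Cauchy's
  inequality on discs of radius proportional to \<open>t\<close> then bounds the derivative
  (\<open>analytic_generator_bound_near_0\<close>), and the semigroup law extends the bound from small \<open>t\<close>
  to bounded intervals.

  The second is the moment inequality \<open>frac_pow_bound\<close> for the Balakrishnan integral of a
  nonnegative operator \<open>B\<close>: the integrand \<open>l powr (\<alpha> - 1) *\<^sub>R (l + B)\<^sup>-\<^sup>1 B x\<close> is bounded both by a
  multiple of \<open>l powr (\<alpha> - 1) * norm x\<close> and by a multiple of
  \<open>l powr (\<alpha> - 2) * norm (B x)\<close>, and the two bounds are used below and above a cut
  \<open>r\<close>. Applied to \<open>B = - A\<close> and \<open>T t x\<close> with \<open>r = 1 / t\<close> it gives the estimate.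

  The fractional power is defined as a closure. On \<open>dom B\<close> it agrees with the Balakrishnan
  integral (\<open>frac_power_eq\<close>), because that integral exists for every vector of \<open>dom B\<close> and
  defines a closable operator. The integrals are Henstock-Kurzweil integrals with values in a
  Banach space that need not be separable, so existence is obtained from domination
  by a real integrable function through continuity of the integrand.
\<close>

section \<open>Improper integrals of continuous vector-valued functions\<close>

text \<open>Domination makes the indefinite integral uniformly continuous up to the singular endpoint,
  and the fundamental theorem of calculus applies to its continuous extension. This argument does
  not require the space of values to be separable.\<close>

lemma integrable_on_Icc_dominated_left:
  fixes f :: "real \<Rightarrow> 'a::banach"
  assumes "a < b" and cont: "continuous_on {a<..b} f"
    and g: "g integrable_on {a..b}"
    and le: "\<And>x. x \<in> {a<..b} \<Longrightarrow> norm (f x) \<le> g x"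
  shows "f integrable_on {a..b}"
proof -
  define F where "F s = integral {s..b} f" for s
  define G where "G s = integral {s..b} g" for s
  have f_int: "f integrable_on {s..t}" if "a < s" "t \<le> b" for s t
    by (rule integrable_continuous_interval, rule continuous_on_subset[OF cont]) (use that in auto)
  have g_int: "g integrable_on {s..t}" if "a \<le> s" "t \<le> b" for s t
    by (rule integrable_on_subinterval[OF g]) (use that in auto)
  have diff: "norm (F s - F t) \<le> \<bar>G s - G t\<bar>" if "a < s" "s \<le> t" "t \<le> b" for s t
  proof -
    have "F s - F t = integral {s..t} f"
      unfolding F_def using Henstock_Kurzweil_Integration.integral_combine[OF that(2,3) f_int] that
      by (metis add_diff_cancel_right' order_refl)
    moreover have "G s - G t = integral {s..t} g"
      unfolding G_def using Henstock_Kurzweil_Integration.integral_combine[OF that(2,3) g_int] that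
      by (metis add_diff_cancel_right' less_le order_refl)
    moreover have "norm (integral {s..t} f) \<le> integral {s..t} g"
      by (rule integral_norm_bound_integral) (use that in \<open>auto intro!: f_int g_int le\<close>)
    ultimately show ?thesis by simp
  qed
  have diff': "dist (F s) (F t) \<le> dist (G s) (G t)" if "s \<in> {a<..b}" "t \<in> {a<..b}" for s t
    using diff[of s t] diff[of t s] that
    by (cases "s \<le> t") (auto simp: dist_norm norm_minus_commute abs_minus_commute)
  have "continuous_on {a..b} G"
    unfolding G_def by (rule indefinite_integral_continuous_1'[OF g])
  then have "uniformly_continuous_on {a..b} G"
    by (rule compact_uniformly_continuous) simp
  then have "uniformly_continuous_on {a<..b} F"
    unfolding uniformly_continuous_on_def
  proof (intro allI impI)
    fix e :: real assume G: "\<forall>e>0. \<exists>d>0. \<forall>x\<in>{a..b}. \<forall>x'\<in>{a..b}. dist x' x < d \<longrightarrow> dist (G x') (G x) < e"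
      and "e > 0"
    obtain d where d: "d > 0"
      "\<And>x x'. x \<in> {a..b} \<Longrightarrow> x' \<in> {a..b} \<Longrightarrow> dist x' x < d \<Longrightarrow> dist (G x') (G x) < e"
      using G \<open>e > 0\<close> by blast
    have "dist (F x') (F x) < e" if "x \<in> {a<..b}" "x' \<in> {a<..b}" "dist x' x < d" for x x'
      using diff'[OF that(2,1)] d(2)[of x x'] that by auto
    then show "\<exists>d>0. \<forall>x\<in>{a<..b}. \<forall>x'\<in>{a<..b}. dist x' x < d \<longrightarrow> dist (F x') (F x) < e"
      using d(1) by blast
  qed
  then obtain h where h: "uniformly_continuous_on (closure {a<..b}) h"
    and hF: "\<And>x. x \<in> {a<..b} \<Longrightarrow> F x = h x"
    by (rule uniformly_continuous_on_extension_on_closure) blast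
  have "continuous_on {a..b} h"
    using uniformly_continuous_imp_continuous[OF h] \<open>a < b\<close> by (simp add: closure_greaterThanAtMost)
  moreover have "((\<lambda>x. - h x) has_vector_derivative f x) (at x)" if x: "x \<in> {a<..<b}" for x
  proof -
    define c where "c = (a + x) / 2"
    have c: "a < c" "c < x" "x < b" using x by (auto simp: c_def)
    have "((\<lambda>u. integral {c..u} f) has_vector_derivative f x) (at x within {c..b})"
      by (rule integral_has_vector_derivative, rule continuous_on_subset[OF cont]) (use c in auto)
    then have "((\<lambda>u. integral {c..u} f) has_vector_derivative f x) (at x)"
      using c by (simp add: at_within_Icc_at)
    then have "((\<lambda>u. integral {c..u} f - F c) has_vector_derivative f x) (at x)"
      by (auto intro!: derivative_eq_intros)
    then show ?thesis
    proof (rule has_vector_derivative_transform_within_open[of _ _ _ "{c<..<b}"])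
      fix u assume u: "u \<in> {c<..<b}"
      have "integral {c..u} f + F u = F c"
        unfolding F_def by (rule Henstock_Kurzweil_Integration.integral_combine)
          (use u c in \<open>auto intro!: f_int\<close>)
      then show "integral {c..u} f - F c = - h u"
        using u c hF[of u] by (simp add: algebra_simps)
    qed (use c in auto)
  qed
  ultimately have "(f has_integral (- h b - - h a)) {a..b}"
    using \<open>a < b\<close>
    by (intro fundamental_theorem_of_calculus_interior) (auto intro!: continuous_intros)
  then show ?thesis by blast
qed

lemma integrable_on_Ioi_dominated:
  fixes f :: "real \<Rightarrow> 'a::banach"
  assumes cont: "continuous_on {0<..} f"
    and g: "g integrable_on {0<..}"
    and le: "\<And>x. x > 0 \<Longrightarrow> norm (f x) \<le> g x"
  shows "f integrable_on {0<..}"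
proof (rule integrable_on_all_intervals_integrable_bound[OF _ _ g])
  have g0: "(\<lambda>x. if x \<in> {0<..} then g x else 0) integrable_on {0..b}" for b
  proof (rule integrable_on_subinterval)
    show "(\<lambda>x. if x \<in> {0<..} then g x else 0) integrable_on UNIV"
      using g by (simp only: integrable_restrict_UNIV)
  qed simp
  fix a b :: real
  have "(\<lambda>x. if x \<in> {0<..} then f x else 0) integrable_on {min a 0..b}"
  proof (cases "0 < b")
    case True
    have "(\<lambda>x. if x \<in> {0<..} then f x else 0) integrable_on {0..b}"
    proof (rule integrable_on_Icc_dominated_left[OF True _ g0])
      have "continuous_on {0<..b} f" by (rule continuous_on_subset[OF cont]) auto
      then show "continuous_on {0<..b} (\<lambda>x. if x \<in> {0<..} then f x else 0)"
        by (rule continuous_on_eq) simp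
    qed (use le in simp)
    moreover have "(\<lambda>x. if x \<in> {0<..} then f x else 0) integrable_on {min a 0..0}"
      by (rule integrable_eq[OF integrable_0]) simp
    ultimately show ?thesis
      using True by (intro Henstock_Kurzweil_Integration.integrable_combine[of "min a 0" 0 b]) auto
  next
    case False
    then show ?thesis by (intro integrable_eq[OF integrable_0]) simp
  qed
  then show "(\<lambda>x. if x \<in> {0<..} then f x else 0) integrable_on cbox a b"
    unfolding cbox_interval by (rule integrable_on_subinterval) auto
qed (use le in auto)

text \<open>Splitting the half-line at \<open>r\<close> gives the interpolation estimate from which the moment
  inequality for fractional powers is read off.\<close>

lemma powr_dominated_integral:
  fixes f :: "real \<Rightarrow> 'a::banach"
  assumes \<alpha>: "0 < \<alpha>" "\<alpha> < 1"
    and cont: "continuous_on {0<..} f"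
    and p: "\<And>l. l > 0 \<Longrightarrow> norm (f l) \<le> p * l powr (\<alpha> - 1)"
    and q: "\<And>l. l > 0 \<Longrightarrow> norm (f l) \<le> q * l powr (\<alpha> - 2)"
  shows powr_dominated_integrable: "f integrable_on {0<..}"
    and powr_dominated_integral_bound:
      "r > 0 \<Longrightarrow> norm (integral {0<..} f) \<le> p * (r powr \<alpha> / \<alpha>) + q * (r powr (\<alpha> - 1) / (1 - \<alpha>))"
proof -
  define g where "g r l = (if l \<le> r then p * l powr (\<alpha> - 1) else q * l powr (\<alpha> - 2))" for r l
  have fg: "norm (f l) \<le> g r l" if "l > 0" for r l
    using p[OF that] q[OF that] by (simp add: g_def)
  have g: "(g r has_integral (p * (r powr \<alpha> / \<alpha>) + q * (r powr (\<alpha> - 1) / (1 - \<alpha>)))) {0<..}"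
    if "r > 0" for r
  proof -
    have "((\<lambda>l. p * l powr (\<alpha> - 1)) has_integral (p * (r powr \<alpha> / \<alpha>))) {0..r}"
      using has_integral_powr_from_0[of "\<alpha> - 1" r] \<alpha> that
      by (intro has_integral_mult_right) simp
    then have 1: "(g r has_integral (p * (r powr \<alpha> / \<alpha>))) {0..r}"
      by (rule has_integral_eq[rotated]) (simp add: g_def)
    have "((\<lambda>l. l powr (\<alpha> - 2)) has_integral (r powr (\<alpha> - 1) / (1 - \<alpha>))) {r..}"
      using has_integral_powr_to_inf[of "\<alpha> - 2" r] \<alpha> that
      by (simp add: minus_divide_left[symmetric] minus_divide_right)
    then have "((\<lambda>l. q * l powr (\<alpha> - 2)) has_integral (q * (r powr (\<alpha> - 1) / (1 - \<alpha>)))) {r..}"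
      by (rule has_integral_mult_right)
    then have 2: "(g r has_integral (q * (r powr (\<alpha> - 1) / (1 - \<alpha>)))) {r..}"
      by (rule has_integral_spike[of "{r}", rotated 2]) (auto simp: g_def)
    have "{0..r} \<inter> {r..} = {r}" "{0..r} \<union> {r..} = {0..}" using that by auto
    then have "(g r has_integral (p * (r powr \<alpha> / \<alpha>) + q * (r powr (\<alpha> - 1) / (1 - \<alpha>)))) {0..}"
      using has_integral_Un[OF 1 2] by simp
    moreover have "{x \<in> {0..} - {0<..}. g r x \<noteq> 0} \<subseteq> {0}"
      "{x \<in> {0<..} - {0..}. g r x \<noteq> 0} \<subseteq> {0}" by auto
    ultimately show ?thesis
      by (subst has_integral_spike_set_eq[of _ "{0..}"])
         (auto intro: negligible_subset[OF negligible_sing])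
  qed
  show int: "f integrable_on {0<..}"
    by (rule integrable_on_Ioi_dominated[OF cont _ fg[of _ 1]]) (use g[of 1] in auto)
  show "norm (integral {0<..} f) \<le> p * (r powr \<alpha> / \<alpha>) + q * (r powr (\<alpha> - 1) / (1 - \<alpha>))"
    if "r > 0"
  proof -
    have "norm (integral {0<..} f) \<le> integral {0<..} (g r)"
      by (rule integral_norm_bound_integral[OF int]) (use g[OF that] fg in auto)
    then show ?thesis using g[OF that] by (simp add: integral_unique)
  qed
qed

section \<open>Complex Hilbert spaces\<close>

lemma norm_scaleC: "norm (c *\<^sub>C x) = cmod c * norm (x::'a::chilbert_space)"
proof -
  have "cinner (c *\<^sub>C x) (c *\<^sub>C x) = c * cnj c * cinner x x"
    by (metis cinner_commute cinner_scaleC_left complex_cnj_mult mult.assoc)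
  then have "complex_of_real ((norm (c *\<^sub>C x))\<^sup>2) = complex_of_real ((cmod c * norm x)\<^sup>2)"
    by (simp add: cinner_self complex_norm_square[symmetric] power_mult_distrib)
  then have "(norm (c *\<^sub>C x))\<^sup>2 = (cmod c * norm x)\<^sup>2"
    by (simp only: of_real_eq_iff)
  then show ?thesis by simp
qed

lemma bounded_linear_scaleC: "bounded_linear ((*\<^sub>C) c :: 'a::chilbert_space \<Rightarrow> 'a)"
proof (rule bounded_linear_intro)
  show "c *\<^sub>C (r *\<^sub>R x) = r *\<^sub>R c *\<^sub>C x" for r and x :: 'a
    by (simp add: scaleR_scaleC scaleC_scaleC mult.commute)
  show "norm (c *\<^sub>C x) \<le> norm x * cmod c" for x :: 'a
    by (simp add: norm_scaleC mult.commute)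
qed (rule scaleC_add_right)

lemma Re_cinner_le: "Re (cinner x y) \<le> norm x * norm (y::'a::chilbert_space)"
proof -
  have lin: "cinner (r *\<^sub>R u) v = of_real r * cinner u v" for r and u v :: 'a
    by (simp add: scaleR_scaleC cinner_scaleC_left)
  have exp: "(norm (u + v))\<^sup>2 = (norm u)\<^sup>2 + 2 * Re (cinner u v) + (norm v)\<^sup>2" for u v :: 'a
  proof -
    have r: "cinner w (u + v) = cinner w u + cinner w v" for w
      by (metis cinner_add_left cinner_commute complex_cnj_add)
    have "complex_of_real ((norm (u + v))\<^sup>2) =
        cinner u u + (cinner u v + cnj (cinner u v)) + cinner v v"
      unfolding cinner_self[symmetric] cinner_add_left r cinner_commute[of v u] by simp
    also have "\<dots> = complex_of_real ((norm u)\<^sup>2 + 2 * Re (cinner u v) + (norm v)\<^sup>2)"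
      by (simp add: cinner_self complex_add_cnj)
    finally show ?thesis by (simp only: of_real_eq_iff)
  qed
  show ?thesis
  proof (cases "norm x = 0 \<or> norm y = 0")
    case True
    have *: "cinner (0::'a) v = 0" for v
      using cinner_add_left[of 0 0 v] by simp
    show ?thesis using True * cinner_commute[of x 0] by auto
  next
    case False
    define u v where "u = norm y *\<^sub>R x" and "v = norm x *\<^sub>R y"
    have nu: "norm u = norm x * norm y" "norm (-v) = norm x * norm y" by (simp_all add: u_def v_def)
    have "cinner u (-v) = cnj (cinner (- v) u)" by (rule cinner_commute)
    also have "- v = (- norm x) *\<^sub>R y" by (simp add: v_def)
    also have "cinner \<dots> u = of_real (- norm x) * cnj (cinner u y)"
      by (simp only: lin cinner_commute[of y u])
    finally have "cinner u (-v) = - of_real (norm x * norm y) * cinner x y"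
      by (simp add: u_def v_def lin mult.assoc mult.left_commute)
    then have "Re (cinner u (-v)) = - (norm x * norm y) * Re (cinner x y)"
      by (simp add: Re_divide)
    moreover have "0 \<le> (norm (u + (-v)))\<^sup>2" by simp
    ultimately have "(norm x * norm y) * Re (cinner x y) \<le> (norm x * norm y) * (norm x * norm y)"
      unfolding exp nu by (simp add: power2_eq_square algebra_simps)
    moreover have "norm x * norm y > 0" using False by simp
    ultimately show ?thesis by (simp add: mult_le_cancel_left_pos)
  qed
qed

lemma norm_cinner_le: "cmod (cinner x y) \<le> norm x * norm (y::'a::chilbert_space)"
proof (cases "cinner x y = 0")
  case False
  \<comment> \<open>rotate \<open>x\<close> so that the inner product becomes a nonnegative real\<close>
  define c where "c = cnj (cinner x y) / of_real (cmod (cinner x y))"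
  have "cmod c = 1" using False by (simp add: c_def norm_divide)
  have "cinner (c *\<^sub>C x) y = of_real (cmod (cinner x y))"
    using False complex_norm_square[of "cinner x y"]
    by (simp add: c_def cinner_scaleC_left power2_eq_square field_simps)
  then have "cmod (cinner x y) = Re (cinner (c *\<^sub>C x) y)" by simp
  also have "\<dots> \<le> norm (c *\<^sub>C x) * norm y" by (rule Re_cinner_le)
  finally show ?thesis using \<open>cmod c = 1\<close> by (simp add: norm_scaleC)
qed simp

lemma bounded_linear_cinner_left: "bounded_linear (\<lambda>x. cinner x (y::'a::chilbert_space))"
proof (rule bounded_linear_intro)
  show "cinner (r *\<^sub>R x) y = r *\<^sub>R cinner x y" for r x
    by (simp only: scaleR_scaleC[where 'a='a] cinner_scaleC_left scaleR_conv_of_real)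
  show "norm (cinner x y) \<le> norm x * norm y" for x by (rule norm_cinner_le)
qed (rule cinner_add_left)

section \<open>A uniform boundedness principle\<close>

text \<open>A local form: if every orbit \<open>U z x\<close> is bounded for \<open>z\<close> near \<open>a\<close>, with a neighbourhood that
  may depend on \<open>x\<close>, then the operators \<open>U z\<close> are uniformly bounded on one neighbourhood.\<close>

lemma eventually_uniformly_bounded:
  fixes U :: "'b::metric_space \<Rightarrow> 'a::banach \<Rightarrow> 'c::real_normed_vector"
  assumes bl: "\<And>z. z \<in> S \<Longrightarrow> bounded_linear (U z)"
    and pw: "\<And>x. \<exists>B. \<forall>\<^sub>F z in at a within S. norm (U z x) \<le> B"
  shows "\<exists>K>0. \<exists>\<rho>>0. \<forall>z\<in>S. z \<noteq> a \<and> dist z a < \<rho> \<longrightarrow> (\<forall>x. norm (U z x) \<le> K * norm x)"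
proof -
  define P where "P n z \<longleftrightarrow> z \<in> S \<and> z \<noteq> a \<and> dist z a < 1 / real (Suc n)" for n z
  define E where "E n = {x. \<forall>z. P n z \<longrightarrow> norm (U z x) \<le> real n}" for n
  have "\<exists>n. x \<in> E n" for x
  proof -
    obtain B where "\<forall>\<^sub>F z in at a within S. norm (U z x) \<le> B" using pw by blast
    then obtain d where d: "d > 0" "\<And>z. z \<in> S \<Longrightarrow> z \<noteq> a \<Longrightarrow> dist z a < d \<Longrightarrow> norm (U z x) \<le> B"
      unfolding eventually_at by blast
    obtain n where n: "real n > max B (1 / d)" using reals_Archimedean2 by blast
    have "1 / real (Suc n) \<le> d" using n d(1) by (simp add: field_simps)
    then have "x \<in> E n" using d(2) n unfolding E_def P_def by force
    then show ?thesis by blast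
  qed
  then have UE: "\<Union>(range E) = UNIV" by blast
  have cl: "closed (E n)" for n
  proof -
    have "E n = (\<Inter>z\<in>Collect (P n). {x. norm (U z x) \<le> real n})" by (auto simp: E_def)
    moreover have "closed {x. norm (U z x) \<le> real n}" if "P n z" for z
      using that by (intro closed_Collect_le continuous_intros
          bounded_linear.continuous_on[OF bl]) (auto simp: P_def)
    ultimately show ?thesis by auto
  qed
  \<comment> \<open>the whole space is the union of the closed sets \<open>E n\<close>, so by Baire one has interior\<close>
  have "\<exists>n. interior (E n) \<noteq> {}"
  proof (rule ccontr)
    assume "\<not> ?thesis"
    then have "Met_TC.mtopology interior_of \<Union>(range E) = {}"
      using cl by (intro Met_TC.metric_Baire_category_alt)
        (auto simp: complete_UNIV)
    then show False using UE by simp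
  qed
  then obtain n x0 e where e: "e > 0" and sub: "cball x0 e \<subseteq> E n"
    by (metis all_not_in_conv mem_interior_cball)
  define K where "K = (2 * real n + 1) / e"
  have "norm (U z x) \<le> K * norm x" if z: "P n z" for z x
  proof (cases "x = 0")
    case True
    interpret bounded_linear "U z" by (rule bl) (use z in \<open>simp add: P_def\<close>)
    show ?thesis using True by (simp add: zero)
  next
    case False
    interpret bounded_linear "U z" by (rule bl) (use z in \<open>simp add: P_def\<close>)
    define u where "u = (e / norm x) *\<^sub>R x"
    have "x0 + u \<in> cball x0 e" "x0 \<in> cball x0 e" using False e by (auto simp: u_def dist_norm)
    then have "norm (U z (x0 + u)) \<le> n" "norm (U z x0) \<le> n"
      using sub z unfolding E_def by blast+
    moreover have "U z u = U z (x0 + u) - U z x0" by (simp add: add)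
    ultimately have "norm (U z u) \<le> 2 * n + 1"
      using norm_triangle_ineq4[of "U z (x0 + u)" "U z x0"] by simp
    then have "e / norm x * norm (U z x) \<le> 2 * n + 1"
      using e by (simp add: u_def scaleR)
    then show ?thesis using e False by (simp add: K_def field_simps)
  qed
  moreover have "K > 0" using e by (simp add: K_def)
  moreover have "1 / real (Suc n) > 0" by simp
  ultimately show ?thesis unfolding P_def by blast
qed

section \<open>Nonnegative operators and their fractional powers\<close>

lemma dom_neg_op [simp]: "dom (neg_op B) = dom B" for B :: "'a \<rightharpoonup> 'a::chilbert_space"
  by (auto simp: neg_op_def dom_def)

lemma the_neg_op: "x \<in> dom B \<Longrightarrow> the (neg_op B x) = - the (B x)" for B :: "'a \<rightharpoonup> 'a::chilbert_space"
  by (auto simp: neg_op_def)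

text \<open>A linear operator \<open>B\<close> is nonnegative if \<open>l + B\<close> is a bijection from \<open>dom B\<close> onto the whole
  space for every \<open>l > 0\<close>, with inverse bounded by \<open>M / l\<close>. No density of the domain is required.\<close>

locale nonneg_operator =
  fixes B :: "'h \<rightharpoonup> 'h::chilbert_space" and M :: real
  assumes M_nonneg: "0 \<le> M"
    and dom_add: "x \<in> dom B \<Longrightarrow> y \<in> dom B \<Longrightarrow> x + y \<in> dom B"
    and dom_scaleC: "x \<in> dom B \<Longrightarrow> c *\<^sub>C x \<in> dom B"
    and op_add: "x \<in> dom B \<Longrightarrow> y \<in> dom B \<Longrightarrow> the (B (x + y)) = the (B x) + the (B y)"
    and op_scaleC: "x \<in> dom B \<Longrightarrow> the (B (c *\<^sub>C x)) = c *\<^sub>C the (B x)"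
    and lower_bound: "x \<in> dom B \<Longrightarrow> 0 < l \<Longrightarrow> l * norm x \<le> M * norm (l *\<^sub>R x + the (B x))"
    and surj: "0 < l \<Longrightarrow> \<exists>x\<in>dom B. l *\<^sub>R x + the (B x) = y"
begin

text \<open>The resolvent \<open>(l + B)\<^sup>-\<^sup>1\<close>.\<close>

definition res :: "real \<Rightarrow> 'h \<Rightarrow> 'h"
  where "res l = inv_into (dom B) (\<lambda>u. l *\<^sub>R u + the (B u))"

lemma dom_scaleR: "x \<in> dom B \<Longrightarrow> r *\<^sub>R x \<in> dom B"
  by (simp add: scaleR_scaleC dom_scaleC del: domIff)

lemma op_scaleR: "x \<in> dom B \<Longrightarrow> the (B (r *\<^sub>R x)) = r *\<^sub>R the (B x)"
  by (simp add: scaleR_scaleC op_scaleC del: domIff)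

lemma dom_diff: "x \<in> dom B \<Longrightarrow> y \<in> dom B \<Longrightarrow> x - y \<in> dom B"
  using dom_add[of x "(-1) *\<^sub>R y"] dom_scaleR[of y "-1"] by (simp del: domIff)

lemma op_diff: "x \<in> dom B \<Longrightarrow> y \<in> dom B \<Longrightarrow> the (B (x - y)) = the (B x) - the (B y)"
  using op_add[of x "(-1) *\<^sub>R y"] dom_scaleR[of y "-1"] op_scaleR[of y "-1"]
  by (simp del: domIff)

lemma inj: "inj_on (\<lambda>u. l *\<^sub>R u + the (B u)) (dom B)" if "0 < l"
proof (rule inj_onI)
  fix x y assume xy: "x \<in> dom B" "y \<in> dom B" "l *\<^sub>R x + the (B x) = l *\<^sub>R y + the (B y)"
  have "l *\<^sub>R (x - y) + the (B (x - y)) = (l *\<^sub>R x + the (B x)) - (l *\<^sub>R y + the (B y))"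
    using xy(1,2) by (simp add: op_diff scaleR_diff_right del: domIff)
  then have "l * norm (x - y) \<le> 0"
    using lower_bound[OF dom_diff[OF xy(1,2)] that] xy(3) by (simp del: domIff)
  then show "x = y" using that by (simp add: mult_le_0_iff)
qed

lemma res_dom: "0 < l \<Longrightarrow> res l y \<in> dom B"
  unfolding res_def using surj[of l y] by (auto intro!: inv_into_into simp del: domIff)

lemma res_eq: "0 < l \<Longrightarrow> l *\<^sub>R res l y + the (B (res l y)) = y"
  unfolding res_def using surj[of l y]
  by (intro f_inv_into_f[where f = "\<lambda>u. l *\<^sub>R u + the (B u)"]) (auto simp del: domIff)

lemma res_unique: "0 < l \<Longrightarrow> u \<in> dom B \<Longrightarrow> l *\<^sub>R u + the (B u) = y \<Longrightarrow> res l y = u"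
  unfolding res_def by (rule inv_into_f_eq[OF inj])

lemma op_res: "0 < l \<Longrightarrow> the (B (res l y)) = y - l *\<^sub>R res l y"
  using res_eq[of l y] by (simp add: algebra_simps)

lemma res_op: "0 < l \<Longrightarrow> x \<in> dom B \<Longrightarrow> res l (the (B x)) = x - l *\<^sub>R res l x"
  by (intro res_unique)
     (auto simp: dom_diff dom_scaleR res_dom op_diff op_scaleR op_res algebra_simps simp del: domIff)

lemma res_add: "0 < l \<Longrightarrow> res l (x + y) = res l x + res l y"
  by (intro res_unique)
     (auto simp: dom_add res_dom op_add op_res algebra_simps simp del: domIff)

lemma res_scaleC: "0 < l \<Longrightarrow> res l (c *\<^sub>C x) = c *\<^sub>C res l x"
proof (intro res_unique)
  assume "0 < l"
  have "l *\<^sub>R c *\<^sub>C res l x = c *\<^sub>C l *\<^sub>R res l x"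
    by (simp add: scaleR_scaleC scaleC_scaleC mult.commute)
  then show "l *\<^sub>R c *\<^sub>C res l x + the (B (c *\<^sub>C res l x)) = c *\<^sub>C x"
    using res_eq[OF \<open>0 < l\<close>, of x] res_dom[OF \<open>0 < l\<close>, of x]
    by (simp add: op_scaleC scaleC_add_right[symmetric] del: domIff)
qed (simp_all add: dom_scaleC res_dom del: domIff)

lemma res_scaleR: "0 < l \<Longrightarrow> res l (r *\<^sub>R x) = r *\<^sub>R res l x"
  by (simp add: scaleR_scaleC res_scaleC)

lemma res_diff: "0 < l \<Longrightarrow> res l (x - y) = res l x - res l y"
  using res_add[of l x "(-1) *\<^sub>R y"] res_scaleR[of l "-1" y] by simp

lemma res_bound: "0 < l \<Longrightarrow> norm (res l y) \<le> M / l * norm y"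
  using lower_bound[OF res_dom, of l l y] res_eq[of l y] by (simp add: pos_le_divide_eq mult_ac)

lemma bounded_linear_res: "0 < l \<Longrightarrow> bounded_linear (res l)"
  by (rule bounded_linear_intro[of _ "M / l"])
     (use res_bound[of l] in \<open>auto simp: res_add res_scaleR mult.commute\<close>)

lemma resolvent_identity:
  assumes "0 < l" "0 < m"
  shows "res l y - res m y = (m - l) *\<^sub>R res l (res m y)"
proof -
  have "m *\<^sub>R res m y + the (B (res m y)) = y" by (rule res_eq[OF assms(2)])
  then have "l *\<^sub>R res m y + the (B (res m y)) = y - (m - l) *\<^sub>R res m y"
    by (simp add: algebra_simps)
  then have "res l (y - (m - l) *\<^sub>R res m y) = res m y"
    using assms by (intro res_unique res_dom)
  then have "res l y - (m - l) *\<^sub>R res l (res m y) = res m y"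
    using assms by (simp only: res_diff res_scaleR)
  then show ?thesis by (simp add: algebra_simps)
qed

lemma res_commute:
  assumes "0 < l" "0 < m"
  shows "res l (res m y) = res m (res l y)"
proof (cases "l = m")
  case False
  have "(m - l) *\<^sub>R res l (res m y) = (m - l) *\<^sub>R res m (res l y)"
    using resolvent_identity[OF assms, of y] resolvent_identity[OF assms(2,1), of y]
    by (metis minus_diff_eq scaleR_minus_left)
  then show ?thesis using False by simp
qed simp

lemma op_res_commute: "0 < l \<Longrightarrow> x \<in> dom B \<Longrightarrow> the (B (res l x)) = res l (the (B x))"
  by (simp add: op_res res_op del: domIff)

lemma continuous_on_res: "continuous_on {0<..} (\<lambda>l. res l y)"
  unfolding continuous_on_def
proof
  fix m :: real assume "m \<in> {0<..}"
  then have m: "0 < m" by simp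
  have "((\<lambda>l. \<bar>m - l\<bar> * (M / l * (M / m * norm y))) \<longlongrightarrow> \<bar>m - m\<bar> * (M / m * (M / m * norm y)))
      (at m within {0<..})"
    using m by (intro tendsto_intros) auto
  then have lim: "((\<lambda>l. \<bar>m - l\<bar> * (M / l * (M / m * norm y))) \<longlongrightarrow> 0) (at m within {0<..})"
    by simp
  have "\<forall>\<^sub>F l in at m within {0<..}.
      norm (res l y - res m y) \<le> \<bar>m - l\<bar> * (M / l * (M / m * norm y))"
  proof (rule eventually_at_filter[THEN iffD2], rule always_eventually, intro allI impI)
    fix l :: real assume "l \<in> {0<..}"
    then have l: "0 < l" by simp
    have "norm (res l (res m y)) \<le> M / l * norm (res m y)" by (rule res_bound[OF l])
    also have "\<dots> \<le> M / l * (M / m * norm y)"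
      using l M_nonneg by (intro mult_left_mono res_bound m) auto
    finally show "norm (res l y - res m y) \<le> \<bar>m - l\<bar> * (M / l * (M / m * norm y))"
      unfolding resolvent_identity[OF l m] norm_scaleR by (rule mult_left_mono) simp
  qed
  then have "((\<lambda>l. res l y - res m y) \<longlongrightarrow> 0) (at m within {0<..})"
    by (rule Lim_null_comparison[OF _ lim])
  then show "((\<lambda>l. res l y) \<longlongrightarrow> res m y) (at m within {0<..})"
    by (simp add: LIM_zero_iff)
qed

subsection \<open>The Balakrishnan integral\<close>

text \<open>The integrand of the Balakrishnan formula without the constant factor, for \<open>x \<in> dom B\<close>.\<close>

definition balakrishnan_integrand :: "real \<Rightarrow> 'h \<Rightarrow> real \<Rightarrow> 'h"
  where "balakrishnan_integrand \<alpha> x l = l powr (\<alpha> - 1) *\<^sub>R res l (the (B x))"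

text \<open>The value of the fractional power on \<open>dom B\<close>; only there is it meaningful.\<close>

definition frac_pow :: "real \<Rightarrow> 'h \<Rightarrow> 'h"
  where "frac_pow \<alpha> x = (sin (pi * \<alpha>) / pi) *\<^sub>R integral {0<..} (balakrishnan_integrand \<alpha> x)"

context
  fixes \<alpha> :: real
  assumes \<alpha>: "0 < \<alpha>" "\<alpha> < 1"
begin

lemma integrand_bounds:
  assumes "x \<in> dom B" "0 < l"
  shows "norm (balakrishnan_integrand \<alpha> x l) \<le> ((1 + M) * norm x) * l powr (\<alpha> - 1)"
    and "norm (balakrishnan_integrand \<alpha> x l) \<le> (M * norm (the (B x))) * l powr (\<alpha> - 2)"
proof -
  have "norm (res l (the (B x))) \<le> norm x + l * norm (res l x)"
    using norm_triangle_ineq4[of x "l *\<^sub>R res l x"] assms by (simp add: res_op)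
  also have "l * norm (res l x) \<le> M * norm x"
    using res_bound[OF \<open>0 < l\<close>, of x] assms by (simp add: field_simps)
  finally have "norm (res l (the (B x))) \<le> (1 + M) * norm x" by (simp add: algebra_simps)
  then show "norm (balakrishnan_integrand \<alpha> x l) \<le> ((1 + M) * norm x) * l powr (\<alpha> - 1)"
    by (simp add: balakrishnan_integrand_def mult.commute[of _ "l powr _"] mult_left_mono)
  have "l powr (\<alpha> - 2) = l powr (\<alpha> - 1) / l"
    using assms powr_diff[of l "\<alpha> - 1" 1] by simp
  moreover have "l powr (\<alpha> - 1) * norm (res l (the (B x)))
      \<le> l powr (\<alpha> - 1) * (M / l * norm (the (B x)))"
    by (intro mult_left_mono res_bound assms) simp
  ultimately show "norm (balakrishnan_integrand \<alpha> x l) \<le> (M * norm (the (B x))) * l powr (\<alpha> - 2)"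
    by (simp add: balakrishnan_integrand_def field_simps)
qed

lemma continuous_on_integrand: "continuous_on {0<..} (balakrishnan_integrand \<alpha> x)"
  unfolding balakrishnan_integrand_def[abs_def]
  by (intro continuous_intros continuous_on_res) auto

lemmas integrand_integrable =
  powr_dominated_integrable[OF \<alpha> continuous_on_integrand integrand_bounds]

lemma integrand_has_integral:
  "x \<in> dom B \<Longrightarrow>
    (balakrishnan_integrand \<alpha> x has_integral integral {0<..} (balakrishnan_integrand \<alpha> x)) {0<..}"
  using integrand_integrable by blast

lemma frac_pow_bound:
  assumes "x \<in> dom B" "0 < r"
  shows "norm (frac_pow \<alpha> x) \<le>
    (1 + M) / \<alpha> * r powr \<alpha> * norm x + M / (1 - \<alpha>) * r powr (\<alpha> - 1) * norm (the (B x))"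
proof -
  have "\<bar>sin (pi * \<alpha>) / pi\<bar> \<le> 1"
    using abs_sin_le_one[of "pi * \<alpha>"] pi_gt3 by (simp add: divide_le_eq del: abs_sin_le_one)
  then have "norm (frac_pow \<alpha> x) \<le> norm (integral {0<..} (balakrishnan_integrand \<alpha> x))"
    unfolding frac_pow_def norm_scaleR by (intro mult_left_le_one_le) auto
  also have "\<dots> \<le> ((1 + M) * norm x) * (r powr \<alpha> / \<alpha>)
      + (M * norm (the (B x))) * (r powr (\<alpha> - 1) / (1 - \<alpha>))"
    by (rule powr_dominated_integral_bound[OF \<alpha> continuous_on_integrand integrand_bounds])
       (use assms in auto)
  finally show ?thesis by (simp add: mult_ac)
qed

lemma frac_pow_add:
  assumes "x \<in> dom B" "y \<in> dom B"
  shows "frac_pow \<alpha> (x + y) = frac_pow \<alpha> x + frac_pow \<alpha> y"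
proof -
  have "((\<lambda>l. balakrishnan_integrand \<alpha> x l + balakrishnan_integrand \<alpha> y l) has_integral
      (integral {0<..} (balakrishnan_integrand \<alpha> x) + integral {0<..} (balakrishnan_integrand \<alpha> y)))
      {0<..}"
    using assms by (intro has_integral_add integrand_has_integral)
  then have "(balakrishnan_integrand \<alpha> (x + y) has_integral
      (integral {0<..} (balakrishnan_integrand \<alpha> x) + integral {0<..} (balakrishnan_integrand \<alpha> y)))
      {0<..}"
    by (rule has_integral_eq[rotated])
       (use assms in \<open>simp add: balakrishnan_integrand_def op_add res_add scaleR_add_right\<close>)
  then show ?thesis
    unfolding frac_pow_def by (simp add: integral_unique scaleR_add_right)
qed

text \<open>The Balakrishnan integral commutes with every bounded operator that commutes with
  \<open>(l + B)\<^sup>-\<^sup>1 B\<close> at the given vector; this is used for complex scalars and for resolvents.\<close>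

lemma frac_pow_commute_bounded_linear:
  assumes h: "bounded_linear h" and "x \<in> dom B"
    and res: "\<And>l. 0 < l \<Longrightarrow> res l (the (B (h x))) = h (res l (the (B x)))"
  shows "frac_pow \<alpha> (h x) = h (frac_pow \<alpha> x)"
proof -
  interpret bounded_linear h by fact
  have "((h \<circ> balakrishnan_integrand \<alpha> x) has_integral
      h (integral {0<..} (balakrishnan_integrand \<alpha> x))) {0<..}"
    by (rule has_integral_linear[OF integrand_has_integral h]) fact
  then have "(balakrishnan_integrand \<alpha> (h x) has_integral
      h (integral {0<..} (balakrishnan_integrand \<alpha> x))) {0<..}"
    by (rule has_integral_eq[rotated]) (simp add: balakrishnan_integrand_def res scaleR)
  then show ?thesis
    unfolding frac_pow_def by (simp add: integral_unique scaleR)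
qed

lemma frac_pow_scaleC: "x \<in> dom B \<Longrightarrow> frac_pow \<alpha> (c *\<^sub>C x) = c *\<^sub>C frac_pow \<alpha> x"
  by (rule frac_pow_commute_bounded_linear[OF bounded_linear_scaleC])
     (auto simp: op_scaleC res_scaleC simp del: domIff)

lemma frac_pow_res: "x \<in> dom B \<Longrightarrow> frac_pow \<alpha> (res 1 x) = res 1 (frac_pow \<alpha> x)"
  by (rule frac_pow_commute_bounded_linear[OF bounded_linear_res])
     (simp_all only: op_res_commute res_commute zero_less_one)

lemma frac_pow_scaleR: "x \<in> dom B \<Longrightarrow> frac_pow \<alpha> (r *\<^sub>R x) = r *\<^sub>R frac_pow \<alpha> x"
  by (simp add: scaleR_scaleC frac_pow_scaleC)

lemma frac_pow_diff: "x \<in> dom B \<Longrightarrow> y \<in> dom B \<Longrightarrow> frac_pow \<alpha> (x - y) = frac_pow \<alpha> x - frac_pow \<alpha> y"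
  using frac_pow_add[of x "(-1) *\<^sub>R y"] frac_pow_scaleR[of y "-1"] dom_scaleR[of y "-1"]
  by (simp del: domIff)

lemma frac_pow_graph_bound:
  "\<exists>K\<ge>0. \<forall>x\<in>dom B. norm (frac_pow \<alpha> x) \<le> K * (norm x + norm (the (B x)))"
proof (intro exI conjI ballI)
  let ?K = "(1 + M) / \<alpha> + M / (1 - \<alpha>)"
  show "0 \<le> ?K" using \<alpha> M_nonneg by simp
  fix x assume "x \<in> dom B"
  then have "norm (frac_pow \<alpha> x) \<le> (1 + M) / \<alpha> * norm x + M / (1 - \<alpha>) * norm (the (B x))"
    using frac_pow_bound[of x 1] by simp
  also have "\<dots> \<le> ?K * norm x + ?K * norm (the (B x))"
    using \<alpha> M_nonneg by (intro add_mono mult_right_mono) auto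
  finally show "norm (frac_pow \<alpha> x) \<le> ?K * (norm x + norm (the (B x)))"
    by (simp add: distrib_left)
qed

lemma continuous_on_frac_pow:
  assumes f: "continuous_on S f" and Bf: "continuous_on S (\<lambda>t. the (B (f t)))"
    and dom: "\<And>t. t \<in> S \<Longrightarrow> f t \<in> dom B"
  shows "continuous_on S (\<lambda>t. frac_pow \<alpha> (f t))"
  unfolding continuous_on_def
proof
  fix s assume s: "s \<in> S"
  obtain K where K: "\<And>x. x \<in> dom B \<Longrightarrow> norm (frac_pow \<alpha> x) \<le> K * (norm x + norm (the (B x)))"
    using frac_pow_graph_bound by blast
  have "((\<lambda>t. K * (norm (f t - f s) + norm (the (B (f t)) - the (B (f s))))) \<longlongrightarrow>
      K * (norm (f s - f s) + norm (the (B (f s)) - the (B (f s))))) (at s within S)"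
    using f Bf s unfolding continuous_on_def by (intro tendsto_intros) blast+
  then have lim: "((\<lambda>t. K * (norm (f t - f s) + norm (the (B (f t)) - the (B (f s))))) \<longlongrightarrow> 0)
      (at s within S)" by simp
  have "\<forall>\<^sub>F t in at s within S. norm (frac_pow \<alpha> (f t) - frac_pow \<alpha> (f s)) \<le>
      K * (norm (f t - f s) + norm (the (B (f t)) - the (B (f s))))"
  proof (rule eventually_at_filter[THEN iffD2], rule always_eventually, intro allI impI)
    fix t assume "t \<in> S"
    then show "norm (frac_pow \<alpha> (f t) - frac_pow \<alpha> (f s)) \<le>
        K * (norm (f t - f s) + norm (the (B (f t)) - the (B (f s))))"
      using K[OF dom_diff[OF dom dom], of t s] s by (simp add: frac_pow_diff op_diff dom del: domIff)
  qed
  then have "((\<lambda>t. frac_pow \<alpha> (f t) - frac_pow \<alpha> (f s)) \<longlongrightarrow> 0) (at s within S)"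
    by (rule Lim_null_comparison[OF _ lim])
  then show "((\<lambda>t. frac_pow \<alpha> (f t)) \<longlongrightarrow> frac_pow \<alpha> (f s)) (at s within S)"
    by (simp add: LIM_zero_iff)
qed

lemma balakrishnan_graph_eq: "balakrishnan_graph B \<alpha> = {(x, frac_pow \<alpha> x) | x. x \<in> dom B}"
proof -
  have eq: "(\<lambda>l. l powr (\<alpha> - 1) *\<^sub>R inv_into (dom B) (\<lambda>u. l *\<^sub>R u + the (B u)) (the (B x))) =
      balakrishnan_integrand \<alpha> x" for x
    by (simp add: balakrishnan_integrand_def res_def fun_eq_iff)
  show ?thesis
    unfolding balakrishnan_graph_def frac_pow_def eq
  proof (intro Collect_cong iffI)
    fix p :: "'h \<times> 'h"
    assume "\<exists>x I. p = (x, (sin (pi * \<alpha>) / pi) *\<^sub>R I) \<and> x \<in> dom B \<and>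
      (balakrishnan_integrand \<alpha> x has_integral I) {0<..}"
    then show "\<exists>x. p = (x, (sin (pi * \<alpha>) / pi) *\<^sub>R integral {0<..} (balakrishnan_integrand \<alpha> x)) \<and>
      x \<in> dom B"
      using integral_unique by blast
  next
    fix p :: "'h \<times> 'h"
    assume "\<exists>x. p = (x, (sin (pi * \<alpha>) / pi) *\<^sub>R integral {0<..} (balakrishnan_integrand \<alpha> x)) \<and>
      x \<in> dom B"
    then show "\<exists>x I. p = (x, (sin (pi * \<alpha>) / pi) *\<^sub>R I) \<and> x \<in> dom B \<and>
      (balakrishnan_integrand \<alpha> x has_integral I) {0<..}"
      using integrand_has_integral by blast
  qed
qed

text \<open>The operator defined by the Balakrishnan integral is closable: composing it with the
  injective operator \<open>(1 + B)\<^sup>-\<^sup>1\<close>, with which it commutes, makes it bounded.\<close>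

lemma closure_balakrishnan_graph:
  assumes x: "x \<in> dom B" and y: "(x, y) \<in> closure (balakrishnan_graph B \<alpha>)"
  shows "y = frac_pow \<alpha> x"
proof -
  obtain K where K: "K \<ge> 0"
    "\<And>x. x \<in> dom B \<Longrightarrow> norm (frac_pow \<alpha> x) \<le> K * (norm x + norm (the (B x)))"
    using frac_pow_graph_bound by blast
  obtain X where X: "\<And>n. X n \<in> balakrishnan_graph B \<alpha>" "X \<longlonglongrightarrow> (x, y)"
    using y unfolding closure_sequential by blast
  define u where "u n = fst (X n)" for n
  have u: "u n \<in> dom B" "snd (X n) = frac_pow \<alpha> (u n)" for n
    using X(1)[of n] unfolding balakrishnan_graph_eq u_def by auto
  have "u \<longlonglongrightarrow> x" unfolding u_def using tendsto_fst[OF X(2)] by simp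
  have "(\<lambda>n. frac_pow \<alpha> (u n)) \<longlonglongrightarrow> y"
    using tendsto_snd[OF X(2)] u(2) by simp
  then have 1: "(\<lambda>n. res 1 (frac_pow \<alpha> (u n))) \<longlonglongrightarrow> res 1 y"
    by (intro bounded_linear.tendsto[OF bounded_linear_res]) simp_all
  have le: "norm (res 1 (frac_pow \<alpha> (u n)) - res 1 (frac_pow \<alpha> x)) \<le>
      K * (2 * M + 1) * norm (u n - x)" for n
  proof -
    have d: "u n - x \<in> dom B" using u(1) x by (rule dom_diff)
    have "res 1 (frac_pow \<alpha> (u n)) - res 1 (frac_pow \<alpha> x) = frac_pow \<alpha> (res 1 (u n - x))"
      using u(1) x d by (simp add: frac_pow_res frac_pow_diff del: domIff flip: res_diff)
    moreover have "norm (frac_pow \<alpha> (res 1 (u n - x))) \<le>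
        K * (norm (res 1 (u n - x)) + norm (the (B (res 1 (u n - x)))))"
      by (rule K(2)[OF res_dom]) simp
    moreover have "norm (the (B (res 1 (u n - x)))) \<le> norm (u n - x) + norm (res 1 (u n - x))"
      using norm_triangle_ineq4[of "u n - x" "res 1 (u n - x)"] by (simp add: op_res)
    moreover have "norm (res 1 (u n - x)) \<le> M * norm (u n - x)"
      using res_bound[of 1 "u n - x"] by simp
    ultimately have "norm (res 1 (frac_pow \<alpha> (u n)) - res 1 (frac_pow \<alpha> x)) \<le>
        K * (norm (res 1 (u n - x)) + norm (the (B (res 1 (u n - x)))))"
      and "norm (res 1 (u n - x)) + norm (the (B (res 1 (u n - x)))) \<le> (2 * M + 1) * norm (u n - x)"
      by (simp_all add: algebra_simps)
    then show ?thesis using mult_left_mono[OF _ K(1)] by (fastforce simp: mult.assoc)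
  qed
  have "(\<lambda>n. K * (2 * M + 1) * norm (u n - x)) \<longlonglongrightarrow> 0"
    using tendsto_mult_right_zero[OF tendsto_norm_zero[OF LIM_zero[OF \<open>u \<longlonglongrightarrow> x\<close>]]] .
  then have "(\<lambda>n. res 1 (frac_pow \<alpha> (u n)) - res 1 (frac_pow \<alpha> x)) \<longlonglongrightarrow> 0"
    by (rule Lim_null_comparison[rotated]) (simp add: le)
  then have "(\<lambda>n. res 1 (frac_pow \<alpha> (u n))) \<longlonglongrightarrow> res 1 (frac_pow \<alpha> x)"
    by (simp add: LIM_zero_iff)
  then have "res 1 y = res 1 (frac_pow \<alpha> x)" using 1 LIMSEQ_unique by blast
  then show ?thesis using res_eq[of 1 y] res_eq[of 1 "frac_pow \<alpha> x"] by simp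
qed

lemma frac_power_eq:
  assumes "x \<in> dom B"
  shows "frac_power B \<alpha> x = Some (frac_pow \<alpha> x)"
proof -
  have "(x, frac_pow \<alpha> x) \<in> balakrishnan_graph B \<alpha>"
    using assms by (simp only: balakrishnan_graph_eq) blast
  then have "(x, frac_pow \<alpha> x) \<in> closure (balakrishnan_graph B \<alpha>)"
    using closure_subset by (rule subsetD[rotated])
  then have "(x, y) \<in> closure (balakrishnan_graph B \<alpha>) \<longleftrightarrow> y = frac_pow \<alpha> x" for y
    using closure_balakrishnan_graph[OF assms] by metis
  then show ?thesis unfolding frac_power_def by simp
qed

end

end

section \<open>Bounded strongly continuous semigroups\<close>

lemma has_vector_derivative_at_right_0D:
  assumes "(f has_vector_derivative D) (at_right 0)"
  shows "((\<lambda>h. (f h - f 0) /\<^sub>R h) \<longlongrightarrow> D) (at_right 0)"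
proof -
  have "((\<lambda>h. (1 / norm (h - 0)) *\<^sub>R (f h - (f 0 + (h - 0) *\<^sub>R D))) \<longlongrightarrow> 0) (at_right 0)"
    using assms unfolding has_vector_derivative_def has_derivative_within by simp
  then have "((\<lambda>h. (f h - f 0) /\<^sub>R h - D) \<longlongrightarrow> 0) (at_right 0)"
    by (rule Lim_transform_eventually)
       (auto intro!: eventually_at_right_less[THEN eventually_mono]
         simp: algebra_simps divide_inverse_commute)
  then show ?thesis by (simp add: LIM_zero_iff)
qed

lemma exp_decay: "0 < l \<Longrightarrow> ((\<lambda>\<tau>. exp (- (l * \<tau>))) \<longlongrightarrow> 0) at_top" for l :: real
  by (rule filterlim_compose[OF exp_at_bot])
     (simp add: filterlim_uminus_at_bot filterlim_tendsto_pos_mult_at_top[OF tendsto_const] filterlim_ident)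

text \<open>Strongly continuous semigroups on a complex Hilbert space that are uniformly bounded in norm
  by an explicit constant \<open>M\<close>.\<close>

locale bounded_C0_semigroup =
  fixes T :: "real \<Rightarrow> 'h::chilbert_space \<Rightarrow> 'h" and M :: real
  assumes C0: "C0_semigroup T"
    and M_nonneg: "0 \<le> M"
    and norm_T_le: "0 \<le> t \<Longrightarrow> norm (T t x) \<le> M * norm x"
begin

lemma bounded_linear_T: "0 \<le> t \<Longrightarrow> bounded_linear (T t)"
  and T_scaleC: "0 \<le> t \<Longrightarrow> T t (c *\<^sub>C x) = c *\<^sub>C T t x"
  and T_zero: "T 0 x = x"
  and T_plus: "0 \<le> s \<Longrightarrow> 0 \<le> t \<Longrightarrow> T (s + t) x = T s (T t x)"
  and T_tendsto_0: "((\<lambda>t. T t x) \<longlongrightarrow> x) (at_right 0)"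
  using C0 unfolding C0_semigroup_def bounded_clinear_def by auto

lemma T_commute: "0 \<le> s \<Longrightarrow> 0 \<le> t \<Longrightarrow> T s (T t x) = T t (T s x)"
  using T_plus[of s t x] T_plus[of t s x] by (simp add: add.commute)

lemma T_add: "0 \<le> t \<Longrightarrow> T t (x + y) = T t x + T t y"
  and T_diff: "0 \<le> t \<Longrightarrow> T t (x - y) = T t x - T t y"
  and T_scaleR: "0 \<le> t \<Longrightarrow> T t (r *\<^sub>R x) = r *\<^sub>R T t x"
  by (simp_all add: bounded_linear_T linear_simps)

subsection \<open>The generator\<close>

lemma generatorI:
  assumes "((\<lambda>t. (T t x - x) /\<^sub>R t) \<longlongrightarrow> y) (at_right 0)"
  shows "x \<in> dom (generator T)" and "the (generator T x) = y"
  using assms tendsto_Lim[OF _ assms]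
  by (auto simp: generator_def dom_def trivial_limit_at_right_real)

lemma generatorD:
  assumes "x \<in> dom (generator T)"
  shows "((\<lambda>t. (T t x - x) /\<^sub>R t) \<longlongrightarrow> the (generator T x)) (at_right 0)"
proof -
  obtain y where y: "((\<lambda>t. (T t x - x) /\<^sub>R t) \<longlongrightarrow> y) (at_right 0)"
    using assms by (auto simp: generator_def dom_def split: if_splits)
  then show ?thesis using generatorI(2)[OF y] by simp
qed

lemma generator_add:
  assumes "x \<in> dom (generator T)" "y \<in> dom (generator T)"
  shows "x + y \<in> dom (generator T)"
    and "the (generator T (x + y)) = the (generator T x) + the (generator T y)"
proof -
  have "((\<lambda>t. (T t x - x) /\<^sub>R t + (T t y - y) /\<^sub>R t) \<longlongrightarrow>
      the (generator T x) + the (generator T y)) (at_right 0)"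
    using assms by (intro tendsto_add generatorD)
  then have "((\<lambda>t. (T t (x + y) - (x + y)) /\<^sub>R t) \<longlongrightarrow>
      the (generator T x) + the (generator T y)) (at_right 0)"
    by (rule Lim_transform_eventually)
       (auto intro!: eventually_at_right_less[THEN eventually_mono] simp: T_add algebra_simps)
  then show "x + y \<in> dom (generator T)"
    and "the (generator T (x + y)) = the (generator T x) + the (generator T y)"
    by (rule generatorI)+
qed

lemma generator_commute_bounded_linear:
  assumes V: "bounded_linear V" and comm: "\<And>h. 0 \<le> h \<Longrightarrow> T h (V x) = V (T h x)"
    and x: "x \<in> dom (generator T)"
  shows "V x \<in> dom (generator T)" and "the (generator T (V x)) = V (the (generator T x))"
proof -
  have "((\<lambda>t. V ((T t x - x) /\<^sub>R t)) \<longlongrightarrow> V (the (generator T x))) (at_right 0)"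
    by (rule bounded_linear.tendsto[OF V generatorD[OF x]])
  then have "((\<lambda>t. (T t (V x) - V x) /\<^sub>R t) \<longlongrightarrow> V (the (generator T x))) (at_right 0)"
    by (rule Lim_transform_eventually)
       (auto intro!: eventually_at_right_less[THEN eventually_mono] simp: comm linear_simps V)
  then show "V x \<in> dom (generator T)" and "the (generator T (V x)) = V (the (generator T x))"
    by (rule generatorI)+
qed

lemma generator_scaleC:
  assumes "x \<in> dom (generator T)"
  shows "c *\<^sub>C x \<in> dom (generator T)"
    and "the (generator T (c *\<^sub>C x)) = c *\<^sub>C the (generator T x)"
  using generator_commute_bounded_linear[OF bounded_linear_scaleC T_scaleC assms] by blast+

lemma generator_T:
  assumes "x \<in> dom (generator T)" "0 \<le> t"
  shows "T t x \<in> dom (generator T)"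
    and "the (generator T (T t x)) = T t (the (generator T x))"
  using generator_commute_bounded_linear[OF bounded_linear_T[OF assms(2)] T_commute assms(1)]
    assms(2) by blast+

subsection \<open>Orbits and truncated Laplace transforms\<close>

lemma continuous_on_orbit: "continuous_on {0..} (\<lambda>t. T t x)"
  unfolding continuous_on_iff
proof (intro ballI allI impI)
  fix s e :: real assume s: "s \<in> {0..}" and "0 < e"
  have "\<forall>\<^sub>F h in at_right 0. dist (T h x) x < e / (M + 1)"
    by (rule tendstoD[OF T_tendsto_0]) (use \<open>0 < e\<close> M_nonneg in auto)
  then obtain d where d: "0 < d" "\<And>h. 0 < h \<Longrightarrow> h < d \<Longrightarrow> dist (T h x) x < e / (M + 1)"
    unfolding eventually_at_right_field by auto
  have *: "dist (T b x) (T a x) < e" if "0 \<le> a" "a < b" "b - a < d" for a b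
  proof -
    have "T b x = T a (T (b - a) x)" using T_plus[of a "b - a" x] that by simp
    then have "dist (T b x) (T a x) \<le> M * dist (T (b - a) x) x"
      using norm_T_le[of a "T (b - a) x - x"] that by (simp add: dist_norm T_diff)
    also have "\<dots> \<le> M * (e / (M + 1))"
      using d(2)[of "b - a"] that M_nonneg by (intro mult_left_mono) auto
    also have "\<dots> < e" using \<open>0 < e\<close> M_nonneg by (simp add: field_simps)
    finally show ?thesis .
  qed
  have "dist (T t x) (T s x) < e" if "t \<in> {0..}" "dist t s < d" for t
    using *[of s t] *[of t s] that s \<open>0 < e\<close>
    by (cases t s rule: linorder_cases) (auto simp: dist_real_def dist_commute)
  then show "\<exists>d>0. \<forall>t\<in>{0..}. dist t s < d \<longrightarrow> dist (T t x) (T s x) < e"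
    using d(1) by blast
qed

text \<open>The truncated Laplace transform of an orbit. It lies in the domain of the generator, which
  makes it a substitute for the resolvent that avoids improper integrals.\<close>

definition laplace :: "real \<Rightarrow> real \<Rightarrow> 'h \<Rightarrow> 'h"
  where "laplace l \<tau> x = integral {0..\<tau>} (\<lambda>t. exp (- (l * t)) *\<^sub>R T t x)"

lemma continuous_on_laplace_integrand:
  "continuous_on {0..} (\<lambda>t. exp (- (l * t)) *\<^sub>R T t x)"
  by (intro continuous_intros continuous_on_orbit)

lemma laplace_integrable:
  "0 \<le> a \<Longrightarrow> (\<lambda>t. exp (- (l * t)) *\<^sub>R T t x) integrable_on {a..b}"
  by (rule integrable_continuous_interval, rule continuous_on_subset)
     (auto intro: continuous_on_laplace_integrand)

lemma laplace_bound:
  assumes "0 < l" "0 \<le> \<tau>"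
  shows "norm (laplace l \<tau> x) \<le> M / l * norm x"
proof -
  have "((\<lambda>t. exp (- (l * t))) has_integral (- exp (- (l * \<tau>)) / l - (- exp (- (l * 0)) / l))) {0..\<tau>}"
    by (rule fundamental_theorem_of_calculus)
       (use assms in \<open>auto intro!: derivative_eq_intros
          simp flip: has_real_derivative_iff_has_vector_derivative\<close>)
  then have int: "((\<lambda>t. exp (- (l * t)) * (M * norm x)) has_integral
      ((1 - exp (- (l * \<tau>))) / l * (M * norm x))) {0..\<tau>}"
    by (intro has_integral_mult_left) (simp add: diff_divide_distrib)
  have "norm (laplace l \<tau> x) \<le> integral {0..\<tau>} (\<lambda>t. exp (- (l * t)) * (M * norm x))"
    unfolding laplace_def
    by (rule integral_norm_bound_integral)
       (use int norm_T_le in \<open>auto intro!: laplace_integrable mult_left_mono\<close>)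
  also have "\<dots> = (1 - exp (- (l * \<tau>))) / l * (M * norm x)" using int by (rule integral_unique)
  also have "\<dots> \<le> 1 / l * (M * norm x)"
    using assms M_nonneg by (intro mult_right_mono divide_right_mono) auto
  finally show ?thesis by simp
qed

lemma linear_laplace: "linear (laplace l \<tau>)"
proof (rule linearI)
  show "laplace l \<tau> (x + y) = laplace l \<tau> x + laplace l \<tau> y" for x y
  proof -
    have "laplace l \<tau> (x + y) =
        integral {0..\<tau>} (\<lambda>t. exp (- (l * t)) *\<^sub>R T t x + exp (- (l * t)) *\<^sub>R T t y)"
      unfolding laplace_def by (rule integral_cong) (simp add: T_add scaleR_add_right)
    then show ?thesis
      unfolding laplace_def by (simp add: integral_add laplace_integrable)
  qed
  show "laplace l \<tau> (r *\<^sub>R x) = r *\<^sub>R laplace l \<tau> x" for r x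
  proof -
    have "laplace l \<tau> (r *\<^sub>R x) = integral {0..\<tau>} (\<lambda>t. r *\<^sub>R (exp (- (l * t)) *\<^sub>R T t x))"
      unfolding laplace_def by (rule integral_cong) (simp add: T_scaleR)
    then show ?thesis unfolding laplace_def by (simp only: integral_cmul)
  qed
qed

lemma bounded_linear_laplace: "0 < l \<Longrightarrow> 0 \<le> \<tau> \<Longrightarrow> bounded_linear (laplace l \<tau>)"
  using linear_laplace[of l \<tau>] laplace_bound[of l \<tau>]
  by (intro bounded_linear_intro[of _ "M / l"]) (auto simp: linear_iff mult.commute)

lemma T_laplace:
  assumes "0 \<le> h"
  shows "T h (laplace l \<tau> x) = integral {0..\<tau>} (\<lambda>t. exp (- (l * t)) *\<^sub>R T (h + t) x)"
proof -
  have "T h (laplace l \<tau> x) = integral {0..\<tau>} (T h \<circ> (\<lambda>t. exp (- (l * t)) *\<^sub>R T t x))"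
    unfolding laplace_def
    by (rule integral_linear[symmetric]) (use assms in \<open>auto intro: laplace_integrable bounded_linear_T\<close>)
  also have "\<dots> = integral {0..\<tau>} (\<lambda>t. exp (- (l * t)) *\<^sub>R T (h + t) x)"
    by (rule integral_cong) (use assms in \<open>simp add: T_scaleR T_plus\<close>)
  finally show ?thesis .
qed

lemma laplace_T_commute:
  assumes "0 \<le> h"
  shows "T h (laplace l \<tau> x) = laplace l \<tau> (T h x)"
  unfolding T_laplace[OF assms] unfolding laplace_def
  by (rule integral_cong) (use assms in \<open>simp add: T_plus add.commute[of h]\<close>)

lemma generator_laplace:
  assumes "0 \<le> \<tau>"
  shows "laplace l \<tau> x \<in> dom (generator T)"
    and "the (generator T (laplace l \<tau> x)) = l *\<^sub>R laplace l \<tau> x + exp (- (l * \<tau>)) *\<^sub>R T \<tau> x - x"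
proof -
  let ?f = "\<lambda>t. exp (- (l * t)) *\<^sub>R T t x"
  \<comment> \<open>translating the integration variable removes the semigroup from the difference quotient\<close>
  have shift: "T h (laplace l \<tau> x) = exp (l * h) *\<^sub>R (laplace l (\<tau> + h) x - laplace l h x)"
    if "0 \<le> h" for h
  proof -
    have "T h (laplace l \<tau> x) = integral {0..\<tau>} (\<lambda>t. exp (l * h) *\<^sub>R (?f \<circ> (+) h) t)"
      unfolding T_laplace[OF that]
      by (rule integral_cong) (simp add: exp_add[symmetric] algebra_simps)
    also have "\<dots> = exp (l * h) *\<^sub>R integral {0..\<tau>} (?f \<circ> (+) h)" by (rule integral_cmul)
    also have "integral {0..\<tau>} (?f \<circ> (+) h) = integral {h..\<tau> + h} ?f"
      using integral_shift_Icc_real[of 0 \<tau> ?f h] by simp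
    also have "\<dots> = laplace l (\<tau> + h) x - laplace l h x"
      unfolding laplace_def
      using Henstock_Kurzweil_Integration.integral_combine[of 0 h "\<tau> + h" ?f] that assms
        laplace_integrable[of 0 l x "\<tau> + h"]
      by (simp add: eq_diff_eq add.commute)
    finally show ?thesis .
  qed
  have deriv: "((\<lambda>u. laplace l u x) has_vector_derivative ?f s) (at_right s)" if "0 \<le> s" for s
  proof -
    have "((\<lambda>u. laplace l u x) has_vector_derivative ?f s) (at s within {0..s + 1})"
      unfolding laplace_def
      by (rule integral_has_vector_derivative, rule continuous_on_subset)
         (use that in \<open>auto intro: continuous_on_laplace_integrand\<close>)
    then have "((\<lambda>u. laplace l u x) has_vector_derivative ?f s) (at s within {s..s + 1})"
      by (rule has_vector_derivative_within_subset) (use that in auto)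
    then show ?thesis by (simp add: at_within_Icc_at_right)
  qed
  have "((\<lambda>h. laplace l (\<tau> + h) x) has_vector_derivative ?f \<tau>) (at_right 0)"
  proof -
    have "((\<lambda>u. laplace l u x) \<circ> (\<lambda>h. \<tau> + h) has_vector_derivative 1 *\<^sub>R ?f \<tau>) (at_right 0)"
    proof (rule vector_diff_chain_within)
      show "((\<lambda>h. \<tau> + h) has_vector_derivative 1) (at_right 0)"
        by (auto intro!: derivative_eq_intros)
      show "((\<lambda>u. laplace l u x) has_vector_derivative ?f \<tau>) (at (\<tau> + 0) within (\<lambda>h. \<tau> + h) ` {0<..})"
        by (rule has_vector_derivative_within_subset[of _ _ _ "{\<tau><..}"])
           (use deriv[OF assms] in auto)
    qed
    then show ?thesis by (simp add: o_def)
  qed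
  then have "((\<lambda>h. exp (l * h) *\<^sub>R (laplace l (\<tau> + h) x - laplace l h x)) has_vector_derivative
      (exp (l * 0) *\<^sub>R (?f \<tau> - ?f 0) + (exp (l * 0) * l) *\<^sub>R (laplace l (\<tau> + 0) x - laplace l 0 x)))
      (at_right 0)"
    by (intro has_vector_derivative_scaleR has_vector_derivative_diff deriv)
       (auto intro!: derivative_eq_intros)
  from has_vector_derivative_at_right_0D[OF this]
  have "((\<lambda>h. (exp (l * h) *\<^sub>R (laplace l (\<tau> + h) x - laplace l h x) - laplace l \<tau> x) /\<^sub>R h) \<longlongrightarrow>
      l *\<^sub>R laplace l \<tau> x + ?f \<tau> - x) (at_right 0)"
    by (simp add: laplace_def T_zero algebra_simps)
  then have "((\<lambda>h. (T h (laplace l \<tau> x) - laplace l \<tau> x) /\<^sub>R h) \<longlongrightarrow>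
      l *\<^sub>R laplace l \<tau> x + ?f \<tau> - x) (at_right 0)"
    by (rule Lim_transform_eventually)
       (auto intro!: eventually_at_right_less[THEN eventually_mono] simp: shift)
  then show "laplace l \<tau> x \<in> dom (generator T)"
    and "the (generator T (laplace l \<tau> x)) = l *\<^sub>R laplace l \<tau> x + exp (- (l * \<tau>)) *\<^sub>R T \<tau> x - x"
    by (rule generatorI)+
qed

subsection \<open>The negative of the generator is nonnegative\<close>

text \<open>For \<open>y = l x - A x\<close> the truncated Laplace transform of \<open>y\<close> is
  \<open>x - exp (- l \<tau>) *\<^sub>R T \<tau> x\<close>; the bound follows by letting \<open>\<tau>\<close> tend to infinity.\<close>

lemma generator_lower_bound:
  assumes x: "x \<in> dom (generator T)" and l: "0 < l"
  shows "l * norm x \<le> M * norm (l *\<^sub>R x - the (generator T x))"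
proof -
  define y where "y = l *\<^sub>R x - the (generator T x)"
  have le: "norm x \<le> M / l * norm y + exp (- (l * \<tau>)) * (M * norm x)" if "0 \<le> \<tau>" for \<tau>
  proof -
    have "laplace l \<tau> y = l *\<^sub>R laplace l \<tau> x - laplace l \<tau> (the (generator T x))"
      unfolding y_def using linear_laplace by (simp add: linear_diff linear_scale)
    also have "laplace l \<tau> (the (generator T x)) = the (generator T (laplace l \<tau> x))"
      by (rule generator_commute_bounded_linear(2)[symmetric])
         (use that l x in \<open>auto intro: bounded_linear_laplace laplace_T_commute\<close>)
    finally have "x = laplace l \<tau> y + exp (- (l * \<tau>)) *\<^sub>R T \<tau> x"
      unfolding generator_laplace(2)[OF that] by (simp add: algebra_simps)
    then have "norm x \<le> norm (laplace l \<tau> y) + exp (- (l * \<tau>)) * norm (T \<tau> x)"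
      using norm_triangle_ineq[of "laplace l \<tau> y" "exp (- (l * \<tau>)) *\<^sub>R T \<tau> x"] by simp
    also have "\<dots> \<le> M / l * norm y + exp (- (l * \<tau>)) * (M * norm x)"
      using that l by (intro add_mono mult_left_mono laplace_bound norm_T_le) auto
    finally show ?thesis .
  qed
  have "((\<lambda>\<tau>. M / l * norm y + exp (- (l * \<tau>)) * (M * norm x)) \<longlongrightarrow>
      M / l * norm y + 0 * (M * norm x)) at_top"
    by (intro tendsto_intros exp_decay l)
  moreover have "\<forall>\<^sub>F \<tau> in at_top. norm x \<le> M / l * norm y + exp (- (l * \<tau>)) * (M * norm x)"
    using eventually_ge_at_top[of 0] by eventually_elim (rule le)
  ultimately have "norm x \<le> M / l * norm y + 0 * (M * norm x)"
    by (rule tendsto_lowerbound) simp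
  then show ?thesis unfolding y_def using l by (simp add: field_simps)
qed

text \<open>Surjectivity of \<open>l - A\<close>: its value at the truncated Laplace transform of \<open>w\<close> is
  \<open>w - exp (- l \<tau>) *\<^sub>R T \<tau> w\<close>, a small perturbation of \<open>w\<close> when \<open>\<tau>\<close> is large, so that \<open>w\<close>
  can be found as the fixed point of a contraction.\<close>

lemma generator_surj:
  assumes l: "0 < l"
  shows "\<exists>u\<in>dom (generator T). l *\<^sub>R u - the (generator T u) = y"
proof -
  have "((\<lambda>\<tau>. exp (- (l * \<tau>)) * M) \<longlongrightarrow> 0 * M) at_top"
    by (intro tendsto_intros exp_decay l)
  then have "\<forall>\<^sub>F \<tau> in at_top. exp (- (l * \<tau>)) * M < 1"
    by (rule order_tendstoD) simp
  then have "\<forall>\<^sub>F \<tau> in at_top. exp (- (l * \<tau>)) * M < 1 \<and> 0 \<le> \<tau>"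
    using eventually_ge_at_top[of 0] by eventually_elim simp
  then obtain \<tau> where \<tau>: "exp (- (l * \<tau>)) * M < 1" "0 \<le> \<tau>"
    unfolding eventually_at_top_linorder by blast
  have "dist (y + exp (- (l * \<tau>)) *\<^sub>R T \<tau> v) (y + exp (- (l * \<tau>)) *\<^sub>R T \<tau> w)
      \<le> exp (- (l * \<tau>)) * M * dist v w" for v w
  proof -
    have "dist (y + exp (- (l * \<tau>)) *\<^sub>R T \<tau> v) (y + exp (- (l * \<tau>)) *\<^sub>R T \<tau> w)
        = norm (exp (- (l * \<tau>)) *\<^sub>R T \<tau> (v - w))"
      using \<tau>(2) by (simp add: dist_norm T_diff scaleR_diff_right)
    also have "\<dots> = exp (- (l * \<tau>)) * norm (T \<tau> (v - w))" by simp
    also have "\<dots> \<le> exp (- (l * \<tau>)) * (M * norm (v - w))"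
      using norm_T_le[OF \<tau>(2)] by (rule mult_left_mono) simp
    finally show ?thesis by (simp add: dist_norm mult.assoc)
  qed
  then have "\<exists>!w. y + exp (- (l * \<tau>)) *\<^sub>R T \<tau> w = w"
    using \<tau> M_nonneg by (intro banach_fix_type[where c = "exp (- (l * \<tau>)) * M"]) auto
  then obtain w where "y + exp (- (l * \<tau>)) *\<^sub>R T \<tau> w = w" by blast
  then have "l *\<^sub>R laplace l \<tau> w - the (generator T (laplace l \<tau> w)) = y"
    unfolding generator_laplace(2)[OF \<tau>(2)] by (simp add: algebra_simps)
  then show ?thesis using generator_laplace(1)[OF \<tau>(2)] by blast
qed

sublocale nonneg_operator "neg_op (generator T)" M
proof
  have minus: "- (c *\<^sub>C z) = c *\<^sub>C - z" for c and z :: 'h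
    using linear_neg[OF bounded_linear.linear[OF bounded_linear_scaleC], of c z] by simp
  fix x y :: 'h and l :: real and c :: complex
  show "0 \<le> M" by (rule M_nonneg)
  show "0 < l \<Longrightarrow> \<exists>x\<in>dom (neg_op (generator T)). l *\<^sub>R x + the (neg_op (generator T) x) = y"
    using generator_surj[of l y] by (simp add: the_neg_op cong: bex_cong del: domIff)
  assume x: "x \<in> dom (neg_op (generator T))"
  then have x': "x \<in> dom (generator T)" by (simp del: domIff)
  show "c *\<^sub>C x \<in> dom (neg_op (generator T))"
    and "the (neg_op (generator T) (c *\<^sub>C x)) = c *\<^sub>C the (neg_op (generator T) x)"
    using generator_scaleC[OF x'] x' by (simp_all add: the_neg_op minus del: domIff)
  show "0 < l \<Longrightarrow> l * norm x \<le> M * norm (l *\<^sub>R x + the (neg_op (generator T) x))"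
    using generator_lower_bound[OF x'] x' by (simp add: the_neg_op del: domIff)
  assume "y \<in> dom (neg_op (generator T))"
  then have y': "y \<in> dom (generator T)" by (simp del: domIff)
  show "x + y \<in> dom (neg_op (generator T))"
    and "the (neg_op (generator T) (x + y)) =
      the (neg_op (generator T) x) + the (neg_op (generator T) y)"
    using generator_add[OF x' y'] x' y' by (simp_all add: the_neg_op del: domIff)
qed

end

section \<open>Analytic semigroups\<close>

text \<open>By scaling, the closed discs about the points \<open>t > 0\<close> of radius a fixed fraction of \<open>t\<close> lie in
  the sector.\<close>

lemma cball_subset_sector:
  assumes "0 < \<delta>"
  shows "\<exists>\<kappa>. 0 < \<kappa> \<and> \<kappa> < 1 \<and> (\<forall>t>0. cball (complex_of_real t) (\<kappa> * t) \<subseteq> sector \<delta>)"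
proof -
  have "isCont Arg 1" by (rule continuous_at_Arg) simp
  then obtain d where d: "0 < d" "\<And>w. dist w 1 < d \<Longrightarrow> dist (Arg w) (Arg 1) < \<delta>"
    using assms unfolding continuous_at_eps_delta by blast
  define \<kappa> where "\<kappa> = min (d / 2) (1 / 2)"
  have "z \<in> sector \<delta>" if t: "0 < t" and z: "z \<in> cball (complex_of_real t) (\<kappa> * t)" for t z
  proof -
    define w where "w = z / complex_of_real t"
    have zw: "z = complex_of_real t * w" using t by (simp add: w_def)
    have "w - 1 = (z - complex_of_real t) / complex_of_real t"
      using t by (simp add: w_def diff_divide_distrib)
    then have "dist w 1 = cmod (z - complex_of_real t) / t"
      using t by (simp add: dist_norm norm_divide)
    also have "\<dots> \<le> \<kappa>"
      using z t by (simp add: dist_norm norm_minus_commute divide_le_eq)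
    finally have "dist w 1 \<le> \<kappa>" .
    then have "dist w 1 < d" "dist w 1 < 1" using d(1) by (auto simp: \<kappa>_def)
    then show ?thesis
      using d(2)[of w] t unfolding sector_def zw by (auto simp: dist_real_def)
  qed
  moreover have "0 < \<kappa>" "\<kappa> < 1" using d(1) by (auto simp: \<kappa>_def)
  ultimately show ?thesis by blast
qed

context bounded_C0_semigroup
begin

text \<open>The key estimate for analytic semigroups. The extension is uniformly bounded near \<open>0\<close> on a
  smaller sector by uniform boundedness, and Cauchy's inequality on a disc of radius proportional
  to \<open>t\<close> bounds the derivative at \<open>t\<close>. Cauchy's inequality is applied to the scalar
  function \<open>\<lambda>z. cinner (U z x) d\<close>, where \<open>d\<close> is the derivative itself.\<close>

lemma analytic_generator_bound_near_0:
  assumes "analytic_semigroup T"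
  shows "\<exists>N\<ge>0. \<exists>r>0. \<forall>t x. 0 < t \<and> t \<le> r \<longrightarrow>
    T t x \<in> dom (generator T) \<and> norm (the (generator T (T t x))) \<le> N / t * norm x"
proof -
  obtain \<delta> U where \<delta>: "0 < \<delta>"
    and UT: "\<forall>t\<ge>0. U (complex_of_real t) = T t"
    and U_bcl: "\<forall>z\<in>sector \<delta>. bounded_clinear (U z)"
    and U_diff: "\<forall>x. \<forall>z\<in>sector \<delta>.
        \<exists>d. ((\<lambda>w. inverse (w - z) *\<^sub>C (U w x - U z x)) \<longlongrightarrow> d) (at z)"
    and U_cont: "\<forall>\<delta>'. 0 < \<delta>' \<and> \<delta>' < \<delta> \<longrightarrow>
        (\<forall>x. ((\<lambda>z. U z x) \<longlongrightarrow> x) (at 0 within sector \<delta>'))"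
    using assms unfolding analytic_semigroup_def by blast
  define S where "S = sector (\<delta> / 2)"
  have S_sub: "S \<subseteq> sector \<delta>" using \<delta> by (auto simp: S_def sector_def)
  have "\<exists>K>0. \<exists>\<rho>>0. \<forall>z\<in>S. z \<noteq> 0 \<and> dist z 0 < \<rho> \<longrightarrow> (\<forall>x. norm (U z x) \<le> K * norm x)"
  proof (rule eventually_uniformly_bounded)
    show "bounded_linear (U z)" if "z \<in> S" for z
      using U_bcl that S_sub by (auto simp: bounded_clinear_def)
    show "\<exists>B. \<forall>\<^sub>F z in at 0 within S. norm (U z x) \<le> B" for x
    proof
      have "((\<lambda>z. norm (U z x)) \<longlongrightarrow> norm x) (at 0 within S)"
        unfolding S_def by (intro tendsto_norm U_cont[rule_format]) (use \<delta> in auto)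
      then have "\<forall>\<^sub>F z in at 0 within S. norm (U z x) < norm x + 1"
        by (rule order_tendstoD) simp
      then show "\<forall>\<^sub>F z in at 0 within S. norm (U z x) \<le> norm x + 1"
        by (rule eventually_mono) simp
    qed
  qed
  then obtain K \<rho> where K: "K > 0" "\<rho> > 0"
    and UK: "\<And>z x. z \<in> S \<Longrightarrow> z \<noteq> 0 \<Longrightarrow> cmod z < \<rho> \<Longrightarrow> norm (U z x) \<le> K * norm x"
    by auto
  obtain \<kappa> where \<kappa>: "0 < \<kappa>" "\<kappa> < 1"
    and disc: "\<And>t. 0 < t \<Longrightarrow> cball (complex_of_real t) (\<kappa> * t) \<subseteq> S"
    using cball_subset_sector[of "\<delta> / 2"] \<delta> unfolding S_def by auto
  have main: "T t x \<in> dom (generator T) \<and>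
      norm (the (generator T (T t x))) \<le> K / \<kappa> / t * norm x"
    if t: "0 < t" "t \<le> \<rho> / 3" for t x
  proof -
    have "complex_of_real t \<in> sector \<delta>"
      using disc[OF t(1)] S_sub \<kappa> t by (auto simp: subset_iff)
    then obtain d where
      d: "((\<lambda>w. inverse (w - complex_of_real t) *\<^sub>C (U w x - U (complex_of_real t) x)) \<longlongrightarrow> d)
        (at (complex_of_real t))"
      using U_diff by blast
    have "filterlim (\<lambda>h. complex_of_real (t + h)) (at (complex_of_real t)) (at_right 0)"
    proof (rule filterlim_atI)
      have "((\<lambda>h. complex_of_real (t + h)) \<longlongrightarrow> complex_of_real (t + 0)) (at_right 0)"
        by (intro tendsto_intros)
      then show "((\<lambda>h. complex_of_real (t + h)) \<longlongrightarrow> complex_of_real t) (at_right 0)" by simp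
      show "\<forall>\<^sub>F h in at_right 0. complex_of_real (t + h) \<noteq> complex_of_real t"
        using eventually_at_right_less[of 0] by eventually_elim simp
    qed
    from filterlim_compose[OF d this]
    have "((\<lambda>h. inverse (complex_of_real (t + h) - complex_of_real t) *\<^sub>C
        (U (complex_of_real (t + h)) x - U (complex_of_real t) x)) \<longlongrightarrow> d) (at_right 0)" .
    then have "((\<lambda>h. (T h (T t x) - T t x) /\<^sub>R h) \<longlongrightarrow> d) (at_right 0)"
    proof (rule Lim_transform_eventually)
      show "\<forall>\<^sub>F h in at_right 0. inverse (complex_of_real (t + h) - complex_of_real t) *\<^sub>C
          (U (complex_of_real (t + h)) x - U (complex_of_real t) x) = (T h (T t x) - T t x) /\<^sub>R h"
        using eventually_at_right_less[of 0]
      proof eventually_elim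
        case (elim h)
        then have "U (complex_of_real (t + h)) x = T h (T t x)"
          using UT[rule_format, of "t + h"] T_plus[of h t x] t by (simp add: add.commute)
        moreover have "U (complex_of_real t) x = T t x" using UT t by simp
        ultimately show ?case by (simp add: scaleR_scaleC)
      qed
    qed
    then have dom: "T t x \<in> dom (generator T)" and d_eq: "the (generator T (T t x)) = d"
      by (rule generatorI)+
    define F where "F z = cinner (U z x) d" for z
    have F_deriv: "(F has_field_derivative cinner e d) (at z)"
      if e: "((\<lambda>w. inverse (w - z) *\<^sub>C (U w x - U z x)) \<longlongrightarrow> e) (at z)" for z e
    proof -
      have "((\<lambda>w. cinner (inverse (w - z) *\<^sub>C (U w x - U z x)) d) \<longlongrightarrow> cinner e d) (at z)"
        by (rule bounded_linear.tendsto[OF bounded_linear_cinner_left e])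
      moreover have "cinner (inverse (w - z) *\<^sub>C (U w x - U z x)) d = (F w - F z) / (w - z)" for w
        by (simp add: F_def cinner_scaleC_left divide_inverse_commute
            linear_diff[OF bounded_linear.linear[OF bounded_linear_cinner_left]])
      ultimately show ?thesis unfolding has_field_derivative_iff by simp
    qed
    have hol: "F holomorphic_on sector \<delta>"
    proof (rule holomorphic_onI)
      fix z assume "z \<in> sector \<delta>"
      then obtain e where "((\<lambda>w. inverse (w - z) *\<^sub>C (U w x - U z x)) \<longlongrightarrow> e) (at z)"
        using U_diff by blast
      from F_deriv[OF this] show "F field_differentiable at z within sector \<delta>"
        using field_differentiable_at_within field_differentiable_def by blast
    qed
    have "cmod ((deriv ^^ 1) F (complex_of_real t)) \<le> fact 1 * (K * norm x * norm d) / (\<kappa> * t) ^ 1"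
    proof (rule Cauchy_inequality)
      show "F holomorphic_on ball (complex_of_real t) (\<kappa> * t)"
        using disc[OF t(1)] S_sub ball_subset_cball
        by (intro holomorphic_on_subset[OF hol]) blast
      show "continuous_on (cball (complex_of_real t) (\<kappa> * t)) F"
        using disc[OF t(1)] S_sub
        by (intro holomorphic_on_imp_continuous_on holomorphic_on_subset[OF hol]) blast
      show "0 < \<kappa> * t" using \<kappa> t by simp
      fix z assume z: "cmod (complex_of_real t - z) = \<kappa> * t"
      then have "z \<in> S" using disc[OF t(1)] by (auto simp: dist_norm)
      moreover have "z \<noteq> 0" using \<open>z \<in> S\<close> by (simp add: S_def sector_def)
      moreover have "cmod z < \<rho>"
      proof -
        have "cmod z \<le> cmod (complex_of_real t) + cmod (complex_of_real t - z)"
          using norm_triangle_ineq4[of "complex_of_real t" "complex_of_real t - z"] by simp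
        also have "\<dots> = t + \<kappa> * t" using z t by simp
        also have "\<kappa> * t \<le> 1 * t" using \<kappa> t by (intro mult_right_mono) auto
        also have "t + 1 * t < \<rho>" using t K by simp
        finally show ?thesis by simp
      qed
      ultimately have "norm (U z x) \<le> K * norm x" by (rule UK)
      then show "cmod (F z) \<le> K * norm x * norm d"
        unfolding F_def using norm_cinner_le[of "U z x" d]
        by (meson mult_right_mono norm_ge_zero order_trans)
    qed
    moreover have "(deriv ^^ 1) F (complex_of_real t) = complex_of_real ((norm d)\<^sup>2)"
      using DERIV_imp_deriv[OF F_deriv[OF d]] by (simp add: cinner_self)
    ultimately have dd: "norm d * norm d \<le> K * norm x / (\<kappa> * t) * norm d"
      by (simp add: power2_eq_square norm_mult)
    have "norm d \<le> K * norm x / (\<kappa> * t)"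
    proof (cases "d = 0")
      case False
      then show ?thesis by (intro mult_right_le_imp_le[OF dd]) simp
    qed (use K \<kappa> t in simp)
    also have "\<dots> = K / \<kappa> / t * norm x" by simp
    finally show ?thesis using dom d_eq by simp
  qed
  then show ?thesis
    using K \<kappa> by (intro exI[of _ "K / \<kappa>"] exI[of _ "\<rho> / 3"] conjI) auto
qed

lemma analytic_dom:
  assumes "analytic_semigroup T" "0 < t"
  shows "T t x \<in> dom (generator T)"
proof -
  obtain r where r: "0 < r" "\<And>s x. 0 < s \<Longrightarrow> s \<le> r \<Longrightarrow> T s x \<in> dom (generator T)"
    using analytic_generator_bound_near_0[OF assms(1)] by blast
  define s where "s = min r t"
  have "T t x = T (t - s) (T s x)" using T_plus[of "t - s" s x] r(1) assms(2) by (simp add: s_def)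
  then show ?thesis
    using generator_T(1)[OF r(2)[of s x], of "t - s"] r(1) assms(2) by (simp add: s_def)
qed

lemma analytic_generator_bound:
  assumes "analytic_semigroup T" "0 < b"
  shows "\<exists>N\<ge>0. \<forall>t x. 0 < t \<and> t \<le> b \<longrightarrow> norm (the (generator T (T t x))) \<le> N / t * norm x"
proof -
  obtain N r where N: "0 \<le> N" "0 < r"
    and dom: "\<And>t x. 0 < t \<Longrightarrow> t \<le> r \<Longrightarrow> T t x \<in> dom (generator T)"
    and le: "\<And>t x. 0 < t \<Longrightarrow> t \<le> r \<Longrightarrow> norm (the (generator T (T t x))) \<le> N / t * norm x"
    using analytic_generator_bound_near_0[OF assms(1)] by blast
  have "norm (the (generator T (T t x))) \<le> max N (M * N * b / r) / t * norm x"
    if t: "0 < t" "t \<le> b" for t x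
  proof (cases "t \<le> r")
    case True
    have "norm (the (generator T (T t x))) \<le> N / t * norm x" using le t True by blast
    also have "\<dots> \<le> max N (M * N * b / r) / t * norm x"
      using t by (intro mult_right_mono divide_right_mono) auto
    finally show ?thesis .
  next
    case False
    have "T t x = T (t - r) (T r x)" using T_plus[of "t - r" r x] False N by simp
    then have "the (generator T (T t x)) = T (t - r) (the (generator T (T r x)))"
      using generator_T(2)[OF dom] False N by simp
    then have "norm (the (generator T (T t x))) \<le> M * norm (the (generator T (T r x)))"
      using norm_T_le[of "t - r"] False by simp
    also have "\<dots> \<le> M * (N / r * norm x)"
      using le[of r x] N M_nonneg by (intro mult_left_mono) auto
    also have "\<dots> = (M * N * t / r) / t * norm x" using t by simp
    also have "\<dots> \<le> max N (M * N * b / r) / t * norm x"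
    proof (intro mult_right_mono divide_right_mono)
      have "M * N * t / r \<le> M * N * b / r"
        using t N M_nonneg by (intro divide_right_mono mult_left_mono) auto
      then show "M * N * t / r \<le> max N (M * N * b / r)" by simp
    qed (use t in auto)
    finally show ?thesis .
  qed
  then show ?thesis using N by (intro exI[of _ "max N (M * N * b / r)"]) auto
qed

text \<open>The choice \<open>r = 1 / t\<close> balances the two terms of the moment inequality.\<close>

lemma analytic_frac_pow_bound:
  assumes an: "analytic_semigroup T" and \<alpha>: "0 < \<alpha>" "\<alpha> < 1" and "0 < b"
  shows "\<exists>K\<ge>0. \<forall>t x. 0 < t \<and> t \<le> b \<longrightarrow> norm (frac_pow \<alpha> (T t x)) \<le> K * t powr (- \<alpha>) * norm x"
proof -
  obtain N where N: "0 \<le> N"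
    "\<And>t x. 0 < t \<Longrightarrow> t \<le> b \<Longrightarrow> norm (the (generator T (T t x))) \<le> N / t * norm x"
    using analytic_generator_bound[OF an \<open>0 < b\<close>] by blast
  define K where "K = (1 + M) / \<alpha> * M + M / (1 - \<alpha>) * N"
  have "norm (frac_pow \<alpha> (T t x)) \<le> K * t powr (- \<alpha>) * norm x" if t: "0 < t" "t \<le> b" for t x
  proof -
    have dom: "T t x \<in> dom (generator T)" by (rule analytic_dom[OF an t(1)])
    have "norm (frac_pow \<alpha> (T t x)) \<le> (1 + M) / \<alpha> * (1 / t) powr \<alpha> * norm (T t x) +
        M / (1 - \<alpha>) * (1 / t) powr (\<alpha> - 1) * norm (the (generator T (T t x)))"
      using frac_pow_bound[OF \<alpha>, of "T t x" "1 / t"] dom t by (simp add: the_neg_op del: domIff)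
    also have "\<dots> \<le> (1 + M) / \<alpha> * (1 / t) powr \<alpha> * (M * norm x) +
        M / (1 - \<alpha>) * (1 / t) powr (\<alpha> - 1) * (N / t * norm x)"
      using t \<alpha> M_nonneg by (intro add_mono mult_left_mono norm_T_le N) auto
    also have "(1 / t) powr \<alpha> = t powr (- \<alpha>)"
      using t by (simp add: powr_minus inverse_powr divide_inverse)
    also have "(1 / t) powr (\<alpha> - 1) = t powr (- \<alpha>) * t"
    proof -
      have "(1 / t) powr (\<alpha> - 1) = inverse (t powr (\<alpha> - 1))"
        using t by (simp add: inverse_powr divide_inverse)
      also have "\<dots> = t powr (- \<alpha> + 1)" by (simp flip: powr_minus)
      also have "\<dots> = t powr (- \<alpha>) * t" using t by (subst powr_add) simp
      finally show ?thesis .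
    qed
    finally show ?thesis using t by (simp add: K_def algebra_simps)
  qed
  moreover have "0 \<le> K" unfolding K_def using \<alpha> N M_nonneg by simp
  ultimately show ?thesis by blast
qed

section \<open>Admissibility\<close>

text \<open>The decay hypothesis is restricted to \<open>t > 0\<close>: at \<open>t = 0\<close> the right-hand side would be \<open>0\<close>
  since \<open>0 powr a = 0\<close>.\<close>

lemma admissibility_bound_of_decay:
  assumes \<alpha>: "\<alpha> < 1 / 2" and \<eta>: "0 < \<eta>"
    and cont: "\<And>x. x \<in> dom (generator T) \<Longrightarrow> continuous_on {0..} (\<lambda>t. the (C (T t x)))"
    and le: "\<And>t x. 0 < t \<Longrightarrow> t \<le> \<eta> \<Longrightarrow> x \<in> dom (generator T) \<Longrightarrow>
      norm (the (C (T t x))) \<le> K * t powr (- \<alpha>) * norm x"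
  shows "admissibility_bound T C \<eta> (K * sqrt (\<eta> powr (1 - 2 * \<alpha>) / (1 - 2 * \<alpha>)))"
  unfolding admissibility_bound_def
proof (intro ballI conjI)
  fix x assume x: "x \<in> dom (generator T)"
  define f where "f t = (norm (the (C (T t x))))\<^sup>2" for t
  have "continuous_on {0..\<eta>} f"
    unfolding f_def by (intro continuous_intros continuous_on_subset[OF cont[OF x]]) auto
  then have int: "f integrable_on {0..\<eta>}" by (rule integrable_continuous_interval)
  then show "(\<lambda>t. (norm (the (C (T t x))))\<^sup>2) integrable_on {0..\<eta>}" unfolding f_def .
  have "((\<lambda>t. t powr (- (2 * \<alpha>))) has_integral (\<eta> powr (1 - 2 * \<alpha>) / (1 - 2 * \<alpha>))) {0..\<eta>}"
    using has_integral_powr_from_0[of "- (2 * \<alpha>)" \<eta>] \<alpha> \<eta> by (simp add: add.commute)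
  then have g: "((\<lambda>t. (K * norm x)\<^sup>2 * t powr (- (2 * \<alpha>))) has_integral
      ((K * norm x)\<^sup>2 * (\<eta> powr (1 - 2 * \<alpha>) / (1 - 2 * \<alpha>)))) {0..\<eta>}"
    by (rule has_integral_mult_right)
  have "((\<lambda>t. if t = 0 then 0 else f t) has_integral integral {0..\<eta>} f) {0..\<eta>}"
    by (rule has_integral_spike[OF negligible_sing[of 0] _ integrable_integral[OF int]]) simp
  moreover have "(if t = 0 then 0 else f t) \<le> (K * norm x)\<^sup>2 * t powr (- (2 * \<alpha>))"
    if "t \<in> {0..\<eta>}" for t
  proof (cases "t = 0")
    case False
    have "f t \<le> (K * t powr (- \<alpha>) * norm x)\<^sup>2"
      unfolding f_def using le[of t x] x that False by (intro power_mono) auto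
    also have "\<dots> = (K * norm x)\<^sup>2 * t powr (- (2 * \<alpha>))"
      using that False powr_add[of t "- \<alpha>" "- \<alpha>"] by (simp add: power2_eq_square)
    finally show ?thesis using False by simp
  qed simp
  ultimately have "integral {0..\<eta>} f \<le> (K * norm x)\<^sup>2 * (\<eta> powr (1 - 2 * \<alpha>) / (1 - 2 * \<alpha>))"
    by (rule has_integral_le[OF _ g])
  then show "integral {0..\<eta>} (\<lambda>t. (norm (the (C (T t x))))\<^sup>2)
      \<le> (K * sqrt (\<eta> powr (1 - 2 * \<alpha>) / (1 - 2 * \<alpha>)))\<^sup>2 * (norm x)\<^sup>2"
    using \<alpha> by (simp add: f_def[abs_def] power_mult_distrib mult_ac)
qed

lemma zero_class_admissible_of_decay:
  assumes \<alpha>: "\<alpha> < 1 / 2"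
    and obs: "observation_operator (generator T) C"
    and cont: "\<And>x. x \<in> dom (generator T) \<Longrightarrow> continuous_on {0..} (\<lambda>t. the (C (T t x)))"
    and decay: "\<And>b. 0 < b \<Longrightarrow> \<exists>K. \<forall>t x. 0 < t \<and> t \<le> b \<and> x \<in> dom (generator T) \<longrightarrow>
      norm (the (C (T t x))) \<le> K * t powr (- \<alpha>) * norm x"
  shows "zero_class_admissible T C"
proof -
  define c where "c \<eta> = sqrt (\<eta> powr (1 - 2 * \<alpha>) / (1 - 2 * \<alpha>))" for \<eta>
  have c_pos: "0 < c \<eta>" if "0 < \<eta>" for \<eta> using that \<alpha> by (simp add: c_def)
  have bound: "\<exists>K>0. \<forall>\<eta>. 0 < \<eta> \<and> \<eta> \<le> b \<longrightarrow> admissibility_bound T C \<eta> (K * c \<eta>)" if b: "0 < b" for b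
  proof -
    obtain K where K: "\<And>t x. 0 < t \<Longrightarrow> t \<le> b \<Longrightarrow> x \<in> dom (generator T) \<Longrightarrow>
        norm (the (C (T t x))) \<le> K * t powr (- \<alpha>) * norm x"
      using decay[OF b] by blast
    have "norm (the (C (T t x))) \<le> max K 1 * t powr (- \<alpha>) * norm x"
      if "0 < t" "t \<le> b" "x \<in> dom (generator T)" for t x
    proof -
      have "K * t powr (- \<alpha>) * norm x \<le> max K 1 * t powr (- \<alpha>) * norm x"
        by (intro mult_right_mono) auto
      then show ?thesis using K[OF that] by linarith
    qed
    \<comment> \<open>admissibility constants have to be positive, whence the maximum\<close>
    then have "admissibility_bound T C \<eta> (max K 1 * c \<eta>)" if "0 < \<eta>" "\<eta> \<le> b" for \<eta>
      unfolding c_def using that by (intro admissibility_bound_of_decay[OF \<alpha>] cont) auto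
    then show ?thesis by (intro exI[of _ "max K 1"]) auto
  qed
  have "finite_time_admissible T C"
    unfolding finite_time_admissible_def
  proof (intro conjI obs allI impI)
    fix \<eta> :: real assume "0 < \<eta>"
    then obtain K where "0 < K" "admissibility_bound T C \<eta> (K * c \<eta>)" using bound[of \<eta>] by auto
    then show "\<exists>K>0. admissibility_bound T C \<eta> K"
      using c_pos[OF \<open>0 < \<eta>\<close>] by (intro exI[of _ "K * c \<eta>"]) simp
  qed
  moreover have "(best_admissibility_constant T C \<longlongrightarrow> 0) (at_right 0)"
  proof -
    obtain K where K: "0 < K" "\<And>\<eta>. 0 < \<eta> \<Longrightarrow> \<eta> \<le> 1 \<Longrightarrow> admissibility_bound T C \<eta> (K * c \<eta>)"
      using bound[of 1] by auto
    have "0 \<le> best_admissibility_constant T C \<eta> \<and> best_admissibility_constant T C \<eta> \<le> K * c \<eta>"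
      if \<eta>: "0 < \<eta>" "\<eta> < 1" for \<eta>
    proof -
      have mem: "K * c \<eta> \<in> {K. K > 0 \<and> admissibility_bound T C \<eta> K}"
        using K \<eta> c_pos by simp
      show ?thesis
        unfolding best_admissibility_constant_def
      proof
        show "0 \<le> Inf {K. K > 0 \<and> admissibility_bound T C \<eta> K}"
          by (rule cInf_greatest) (use mem in auto)
        show "Inf {K. K > 0 \<and> admissibility_bound T C \<eta> K} \<le> K * c \<eta>"
          by (rule cInf_lower[OF mem]) (auto intro!: bdd_belowI[of _ 0])
      qed
    qed
    then have "\<forall>\<^sub>F \<eta> in at_right 0. 0 \<le> best_admissibility_constant T C \<eta>"
      and "\<forall>\<^sub>F \<eta> in at_right 0. best_admissibility_constant T C \<eta> \<le> K * c \<eta>"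
      unfolding eventually_at_right_field by (auto intro!: exI[of _ 1])
    moreover have "((\<lambda>\<eta>. K * c \<eta>) \<longlongrightarrow> 0) (at_right 0)"
    proof -
      have "\<forall>\<^sub>F \<eta> in at_right 0. 0 \<le> (\<eta>::real)"
        using eventually_at_right_less[of 0] by eventually_elim simp
      then have "((\<lambda>\<eta>. \<eta> powr (1 - 2 * \<alpha>)) \<longlongrightarrow> 0 powr (1 - 2 * \<alpha>)) (at_right 0)"
        using \<alpha> by (intro tendsto_powr2 tendsto_intros) auto
      then have "((\<lambda>\<eta>. K * c \<eta>) \<longlongrightarrow> K * sqrt (0 powr (1 - 2 * \<alpha>) / (1 - 2 * \<alpha>))) (at_right 0)"
        unfolding c_def using \<alpha>
        by (intro tendsto_mult tendsto_real_sqrt tendsto_divide tendsto_const) auto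
      then show ?thesis by simp
    qed
    ultimately show ?thesis
      by (rule tendsto_sandwich[OF _ _ tendsto_const])
  qed
  ultimately show ?thesis unfolding zero_class_admissible_def by blast
qed

end

theorem theorem3p5:
  fixes T :: "real \<Rightarrow> 'h::chilbert_space \<Rightarrow> 'h"
    and A :: "'h \<rightharpoonup> 'h"
    and S :: "'h \<Rightarrow> 'y::chilbert_space"
    and C :: "'h \<rightharpoonup> 'y"
    and \<alpha> :: real
  assumes "C0_semigroup T"
    and "analytic_semigroup T"
    and "bounded_semigroup T"
    and "A = generator T"
    and "bounded_clinear S"
    and "0 < \<alpha>" and "\<alpha> < 1 / 2"
    and "C = (map_option S \<circ> frac_power (neg_op A) \<alpha>) |` dom A"
  shows "zero_class_admissible T C"
proof -
  obtain M where M: "\<And>t x. 0 \<le> t \<Longrightarrow> norm (T t x) \<le> M * norm x"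
    using assms(3) unfolding bounded_semigroup_def by blast
  \<comment> \<open>\<open>M\<close> may be negative if the space is trivial\<close>
  interpret bounded_C0_semigroup T "max M 0"
  proof
    fix t :: real and x :: 'h assume "0 \<le> t"
    have "M * norm x \<le> max M 0 * norm x" by (intro mult_right_mono) auto
    then show "norm (T t x) \<le> max M 0 * norm x" using M[OF \<open>0 \<le> t\<close>, of x] by linarith
  qed (use assms(1) in auto)
  have \<alpha>1: "\<alpha> < 1" using assms(7) by simp
  interpret S: bounded_linear S using assms(5) unfolding bounded_clinear_def by blast
  have S_scaleC: "S (c *\<^sub>C x) = c *\<^sub>C S x" for c x
    using assms(5) unfolding bounded_clinear_def by blast
  obtain L where L: "0 \<le> L" "\<And>x. norm (S x) \<le> L * norm x"
    using S.nonneg_bounded by (auto simp: mult.commute)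
  have C: "C x = Some (S (frac_pow \<alpha> x))" if "x \<in> dom (generator T)" for x
  proof -
    have "frac_power (neg_op (generator T)) \<alpha> x = Some (frac_pow \<alpha> x)"
      by (rule frac_power_eq[OF assms(6) \<alpha>1]) (use that in \<open>simp del: domIff\<close>)
    then show ?thesis using that unfolding assms(8) assms(4) by (simp del: domIff)
  qed
  have dom_C: "dom C = dom (generator T)"
  proof
    show "dom C \<subseteq> dom (generator T)" unfolding assms(8) assms(4) by (simp del: domIff)
    show "dom (generator T) \<subseteq> dom C" using C by (auto simp del: domIff intro: domI)
  qed
  show ?thesis
  proof (rule zero_class_admissible_of_decay[OF assms(7)])
    obtain K where K: "0 \<le> K" "\<And>x. x \<in> dom (neg_op (generator T)) \<Longrightarrow>
        norm (frac_pow \<alpha> x) \<le> K * (norm x + norm (the (neg_op (generator T) x)))"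
      using frac_pow_graph_bound[OF assms(6) \<alpha>1] by blast
    have "norm (the (C x)) \<le> (L * K) * (norm x + norm (the (generator T x)))"
      if "x \<in> dom (generator T)" for x
    proof -
      have "norm (the (C x)) \<le> L * norm (frac_pow \<alpha> x)" using L(2) C[OF that] by simp
      also have "\<dots> \<le> L * (K * (norm x + norm (the (generator T x))))"
        using K(2)[of x] that L(1) by (intro mult_left_mono) (simp_all add: the_neg_op del: domIff)
      finally show ?thesis by (simp add: mult.assoc)
    qed
    then show "observation_operator (generator T) C"
      unfolding observation_operator_def
      using dom_C C generator_add(1) generator_scaleC(1)
        frac_pow_add[OF assms(6) \<alpha>1] frac_pow_scaleC[OF assms(6) \<alpha>1]
      by (auto simp: S.add S_scaleC simp del: domIff)
  next
    fix x assume x: "x \<in> dom (generator T)"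
    have "continuous_on {0..} (\<lambda>t. frac_pow \<alpha> (T t x))"
    proof (rule continuous_on_frac_pow[OF assms(6) \<alpha>1 continuous_on_orbit])
      have "continuous_on {0..} (\<lambda>t. - T t (the (generator T x)))"
        by (intro continuous_intros continuous_on_orbit)
      then show "continuous_on {0..} (\<lambda>t. the (neg_op (generator T) (T t x)))"
        by (rule continuous_on_eq)
          (use generator_T[OF x] in \<open>simp add: the_neg_op del: domIff\<close>)
    qed (use generator_T(1)[OF x] in \<open>simp del: domIff\<close>)
    then have "continuous_on {0..} (\<lambda>t. S (frac_pow \<alpha> (T t x)))" by (rule S.continuous_on)
    then show "continuous_on {0..} (\<lambda>t. the (C (T t x)))"
      by (rule continuous_on_eq) (use generator_T(1)[OF x] C in \<open>simp del: domIff\<close>)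
  next
    fix b :: real assume "0 < b"
    then obtain K where K: "\<And>t x. 0 < t \<Longrightarrow> t \<le> b \<Longrightarrow>
        norm (frac_pow \<alpha> (T t x)) \<le> K * t powr (- \<alpha>) * norm x"
      using analytic_frac_pow_bound[OF assms(2,6) \<alpha>1] by blast
    have "norm (the (C (T t x))) \<le> (L * K) * t powr (- \<alpha>) * norm x" if t: "0 < t" "t \<le> b" for t x
    proof -
      have "norm (the (C (T t x))) \<le> L * norm (frac_pow \<alpha> (T t x))"
        using L(2) C[OF analytic_dom[OF assms(2) t(1)]] by simp
      also have "\<dots> \<le> L * (K * t powr (- \<alpha>) * norm x)" by (intro mult_left_mono K t L(1))
      finally show ?thesis by (simp add: mult.assoc)
    qed
    then show "\<exists>K. \<forall>t x. 0 < t \<and> t \<le> b \<and> x \<in> dom (generator T) \<longrightarrow>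
        norm (the (C (T t x))) \<le> K * t powr (- \<alpha>) * norm x" by blast
  qed
qed

end
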